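(* If $f\in\mathcal{M}$ is pretentious and takes finitely many values, then $f$ has a unique Furstenberg system, and this system is ergodic. In fact, $f$ is RAP.
   Context: $\mathcal{M}$ is the class of multiplicative functions $f:\mathbb{N}\to\mathbb{C}$ ($f(mn)=f(m)f(n)$ for coprime $m,n$) with $|f|\le1$. $f\in\mathcal{M}$ is pretentious if there are a Dirichlet character $\chi$ and $t\in\mathbb{R}$ with $\sum_{p\text{ prime}}\frac1p\big(1-\mathrm{Re}(f(p)\overline{\chi(p)p^{it}})\big)<+\infty$. Furstenberg systems: let $\mathbb{U}$ be the closed unit disc and $S$ the left shift on $\mathbb{U}^{\mathbb{Z}}$; view $f$ as an element of $\mathbb{U}^{\mathbb{Z}}$ (extended e.g. by $0$ to non-positive integers) and let $X_f=\overline{\{S^nf:n\in\mathbb{Z}\}}$. A Furstenberg system of $f$ is any system $(X_f,\nu,S)$ with $\nu$ a weak$^*$ limit $\lim_{k\to\infty}\frac1{N_k}\sum_{n\le N_k}\delta_{S^nf}$ for some $N_k\to\infty$. It is unique if $\lim_{N\to\infty}\frac1N\sum_{n\le N}\delta_{S^nf}$ exists in the weak$^*$ topology. $f$ is (Besicovitch) rationally almost periodic (RAP) if for each $\varepsilon>0$ there is a periodic sequence $f_\varepsilon$ with $\limsup_{N\to\infty}\frac1N\sum_{n<N}|f(n)-f_\varepsilon(n)|<\varepsilon$. *)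

theory Defs
  imports "HOL-Probability.Probability" "HOL-Computational_Algebra.Primes"
begin

text \<open>
  The domain of arithmetic functions is the set of positive integers. They are modelled by
  functions on \<open>nat\<close>, and no definition below depends on the value at \<open>0\<close>.
\<close>

definition mult_unit_disc :: "(nat \<Rightarrow> complex) set" where
  "mult_unit_disc =
     {f. (\<forall>m>0. \<forall>n>0. coprime m n \<longrightarrow> f (m * n) = f m * f n) \<and> (\<forall>n>0. norm (f n) \<le> 1)}"

definition dirichlet_character :: "nat \<Rightarrow> (nat \<Rightarrow> complex) \<Rightarrow> bool" where
  "dirichlet_character q \<psi> \<longleftrightarrow>
     q > 0 \<and> (\<forall>m n. \<psi> (m * n) = \<psi> m * \<psi> n) \<and> (\<forall>n. \<psi> (n + q) = \<psi> n) \<and>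
     (\<forall>n. \<psi> n \<noteq> 0 \<longleftrightarrow> coprime n q)"

text \<open>
  For \<open>f\<close> in \<^const>\<open>mult_unit_disc\<close> the terms of the series are nonnegative, so that
  summability says exactly that the sum is less than \<open>+\<infinity>\<close>.
\<close>

definition pretentious :: "(nat \<Rightarrow> complex) \<Rightarrow> bool" where
  "pretentious f \<longleftrightarrow> (\<exists>q \<psi> (t::real). dirichlet_character q \<psi> \<and>
     (\<lambda>p. 1 / real p * (1 - Re (f p * cnj (\<psi> p * of_nat p powr (\<i> * of_real t)))))
       summable_on {p. prime p})"

text \<open>\<open>shift_by k\<close> is the \<open>k\<close>-th iterate of the left shift, where \<open>k\<close> may be negative.\<close>

definition shift_by :: "int \<Rightarrow> (int \<Rightarrow> 'a) \<Rightarrow> int \<Rightarrow> 'a" where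
  "shift_by k x = (\<lambda>m. x (m + k))"

abbreviation left_shift :: "(int \<Rightarrow> 'a) \<Rightarrow> int \<Rightarrow> 'a" where
  "left_shift \<equiv> shift_by 1"

definition extend_zero :: "(nat \<Rightarrow> complex) \<Rightarrow> int \<Rightarrow> complex" where
  "extend_zero f = (\<lambda>m. if m > 0 then f (nat m) else 0)"

text \<open>
  The closure is taken in the product topology on \<^typ>\<open>int \<Rightarrow> complex\<close>. If \<open>\<bar>f\<bar> \<le> 1\<close>, the orbit
  lies in the compact set of bi-infinite sequences with values in the closed unit disc, and this is
  the same as the closure in that set.
\<close>

definition orbit_closure :: "(nat \<Rightarrow> complex) \<Rightarrow> (int \<Rightarrow> complex) set" where
  "orbit_closure f = closure {shift_by k (extend_zero f) | k. True}"

text \<open>The measure \<open>(1/N) \<Sum>\<^sub>n\<^sub>\<le>\<^sub>N \<delta>\<close>, with unit masses at the shifts by \<open>n\<close>, on the orbit closure.\<close>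

definition empirical_measure :: "(nat \<Rightarrow> complex) \<Rightarrow> nat \<Rightarrow> (int \<Rightarrow> complex) measure" where
  "empirical_measure f N =
     distr (uniform_count_measure {1..N}) (restrict_space borel (orbit_closure f))
       (\<lambda>n. shift_by (int n) (extend_zero f))"

definition weak_star_tendsto ::
  "'a::topological_space set \<Rightarrow> (nat \<Rightarrow> 'a measure) \<Rightarrow> 'a measure \<Rightarrow> bool" where
  "weak_star_tendsto X \<mu> \<nu> \<longleftrightarrow>
     prob_space \<nu> \<and> sets \<nu> = sets (restrict_space borel X) \<and>
     (\<forall>g::'a \<Rightarrow> real. continuous_on X g \<longrightarrow>
        (\<lambda>k. \<integral>x. g x \<partial>\<mu> k) \<longlonglongrightarrow> (\<integral>x. g x \<partial>\<nu>))"

text \<open>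
  A Furstenberg system of \<open>f\<close> is given by its measure \<open>\<nu>\<close>; its underlying space is
  \<^term>\<open>orbit_closure f\<close> and its transformation is \<^term>\<open>left_shift\<close>.
\<close>

definition furstenberg_system :: "(nat \<Rightarrow> complex) \<Rightarrow> (int \<Rightarrow> complex) measure \<Rightarrow> bool" where
  "furstenberg_system f \<nu> \<longleftrightarrow> (\<exists>N :: nat \<Rightarrow> nat. filterlim N at_top sequentially \<and>
     weak_star_tendsto (orbit_closure f) (\<lambda>k. empirical_measure f (N k)) \<nu>)"

definition unique_furstenberg_system :: "(nat \<Rightarrow> complex) \<Rightarrow> bool" where
  "unique_furstenberg_system f \<longleftrightarrow>
     (\<exists>\<nu>. weak_star_tendsto (orbit_closure f) (empirical_measure f) \<nu>)"

definition ergodic_system :: "'a measure \<Rightarrow> ('a \<Rightarrow> 'a) \<Rightarrow> bool" where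
  "ergodic_system \<nu> T \<longleftrightarrow>
     prob_space \<nu> \<and> T \<in> measurable \<nu> \<nu> \<and> distr \<nu> \<nu> T = \<nu> \<and>
     (\<forall>A\<in>sets \<nu>. T -` A \<inter> space \<nu> = A \<longrightarrow> measure \<nu> A = 0 \<or> measure \<nu> A = 1)"

definition periodic_seq :: "(nat \<Rightarrow> 'a) \<Rightarrow> bool" where
  "periodic_seq g \<longleftrightarrow> (\<exists>r>0. \<forall>n. g (n + r) = g n)"

definition rationally_almost_periodic :: "(nat \<Rightarrow> complex) \<Rightarrow> bool" where
  "rationally_almost_periodic f \<longleftrightarrow> (\<forall>\<epsilon>>0. \<exists>g. periodic_seq g \<and>
     limsup (\<lambda>N. ereal (1 / real N * (\<Sum>n\<in>{1..<N}. norm (f n - g n)))) < ereal \<epsilon>)"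

lemma integral_empirical_measure:
  fixes g :: "(int \<Rightarrow> complex) \<Rightarrow> real"
  assumes "continuous_on (orbit_closure f) g"
  shows "(\<integral>x. g x \<partial>empirical_measure f N) =
           1 / real N * (\<Sum>n=1..N. g (shift_by (int n) (extend_zero f)))"
proof -
  have mem: "shift_by k (extend_zero f) \<in> orbit_closure f" for k
    unfolding orbit_closure_def by (rule subsetD[OF closure_subset]) auto
  have "(\<lambda>n. shift_by (int n) (extend_zero f)) \<in>
      measurable (uniform_count_measure {1..N}) (restrict_space borel (orbit_closure f))"
    by (auto simp: measurable_def space_restrict_space space_uniform_count_measure
          sets_uniform_count_measure mem)
  moreover have "g \<in> borel_measurable (restrict_space borel (orbit_closure f))"
    using assms by (rule borel_measurable_continuous_on_restrict)
  ultimately show ?thesis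
    unfolding empirical_measure_def
    by (simp add: integral_distr uniform_count_measure_def lebesgue_integral_point_measure_finite
          sum_divide_distrib)
qed

end

theory Submission
  imports Defs "HOL-Real_Asymp.Real_Asymp"
begin

text \<open>
  If \<open>f\<close> pretends to be \<open>\<psi>(n) n\<^sup>i\<^sup>t\<close> with \<open>t \<noteq> 0\<close>, then \<open>p\<^sup>i\<^sup>t\<close> is close to a fixed finite set of unimodular
  numbers for most primes \<open>p\<close>, and for a suitable \<open>k > 0\<close> the number \<open>p\<^sup>i\<^sup>k\<^sup>t\<close> is close to \<open>1\<close>. This
  contradicts the boundedness of \<open>\<zeta>\<close> near \<open>1 + i k t\<close>. So \<open>t = 0\<close>, and, there being finitely many
  values, \<open>f p = \<psi> p\<close> outside a set of primes with convergent sum of reciprocals. Such an \<open>f\<close> agrees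
  with a periodic sequence outside a set of small density.

  By uniform continuity, \<open>n \<mapsto> h(S\<^sup>n f)\<close> is then almost periodic in mean for every continuous \<open>h\<close>, so
  that its averages converge and its averages over suitable blocks are close in mean to a constant.
  The former gives uniqueness of the Furstenberg system, the latter its ergodicity.
\<close>

section \<open>Approximation by periodic sequences\<close>

text \<open>Finiteness of the value set is used as a gap. The numbers
  \<open>f p * cnj (\<psi> p)\<close> form a finite set, so those of modulus below 1, or of real
  part below 1, keep a fixed distance from 1. The gap in modulus forces them onto the unit circle
  for most primes, where simultaneous Diophantine approximation supplies the exponent k; the gap in
  real part turns closeness to 1 into equality. With s = 1 + \<sigma> + i k t, an upper bound for
  |zeta(s)| bounds the real part of the sum of p^(-s) from above. This is the right side: that real
  part would otherwise exceed half of the sum of p^(-1-\<sigma>), up to a constant. Equality off a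
  set of small density, not merely smallness in mean, also serves the dynamics: it is inherited by
  whole windows, and a window determines a continuous function on the orbit closure up to a small
  error. Convergence of all averages does not by itself exhibit a measure. As the values are finite
  in number, the orbit closure embeds in the real line by a digit expansion, and there a limit can
  be extracted from the empirical measures.\<close>

lemma dirichlet_character_periodic:
  assumes "dirichlet_character q \<psi>"
  shows "\<psi> (n + q * k) = \<psi> n"
proof (induction k)
  case (Suc k)
  have "\<psi> (n + q * Suc k) = \<psi> ((n + q * k) + q)" by (simp add: algebra_simps)
  also have "\<dots> = \<psi> (n + q * k)" using assms unfolding dirichlet_character_def by blast
  finally show ?case using Suc by simp
qed simp

lemma dirichlet_character_finite_range:
  assumes "dirichlet_character q \<psi>"
  shows "finite (range \<psi>)"
proof -
  have "\<psi> n \<in> \<psi> ` {..<q}" for n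
  proof -
    have "q > 0" using assms by (simp add: dirichlet_character_def)
    moreover have "\<psi> n = \<psi> (n mod q)"
      using dirichlet_character_periodic[OF assms, of "n mod q" "n div q"] by simp
    ultimately show ?thesis by auto
  qed
  then have "range \<psi> \<subseteq> \<psi> ` {..<q}" by auto
  then show ?thesis using finite_subset by blast
qed

lemma dirichlet_character_1:
  assumes "dirichlet_character q \<psi>"
  shows "\<psi> 1 = 1"
proof -
  have "\<psi> (1 * 1) = \<psi> 1 * \<psi> 1" "\<psi> 1 \<noteq> 0"
    using assms unfolding dirichlet_character_def by (blast, simp)
  then show ?thesis by simp
qed

text \<open>The powers of \<open>\<psi> n\<close> are again values of \<open>\<psi>\<close>, hence
  finite in number; a modulus above 1 would make them unbounded.\<close>

lemma dirichlet_character_norm_le_1: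
  assumes "dirichlet_character q \<psi>"
  shows "norm (\<psi> n) \<le> 1"
proof (rule ccontr)
  assume "\<not> norm (\<psi> n) \<le> 1"
  then have gt: "norm (\<psi> n) > 1" by simp
  have pow: "\<psi> (n ^ k) = \<psi> n ^ k" for k
  proof (induction k)
    case 0
    show ?case using dirichlet_character_1[OF assms] by simp
  next
    case (Suc k)
    have "\<psi> (n * n ^ k) = \<psi> n * \<psi> (n ^ k)"
      using assms unfolding dirichlet_character_def by blast
    with Suc show ?case by simp
  qed
  have "bounded (range \<psi>)"
    using dirichlet_character_finite_range[OF assms] by (rule finite_imp_bounded)
  then obtain C where C: "\<And>m. norm (\<psi> m) \<le> C" unfolding bounded_iff by auto
  obtain k where "C < norm (\<psi> n) ^ k" using real_arch_pow[OF gt] by blast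
  with C[of "n ^ k"] show False by (simp add: pow norm_power)
qed

text \<open>A finite part \<open>F\<close> of \<open>A\<close> carries the sum up to
  \<open>e\<close>, and \<open>y\<close> is its largest member. A set beyond \<open>y\<close> is
  disjoint from \<open>F\<close>, so its sum fits into the remainder.\<close>

lemma sum_tail_le:
  fixes g :: "nat \<Rightarrow> real"
  assumes "g summable_on A" "\<And>x. x \<in> A \<Longrightarrow> g x \<ge> 0" "e > 0"
  obtains y where "\<And>D. finite D \<Longrightarrow> D \<subseteq> A \<Longrightarrow> (\<And>d. d \<in> D \<Longrightarrow> y < d) \<Longrightarrow> sum g D \<le> e"
proof -
  have "(g has_sum infsum g A) A" using assms(1) by simp
  then have "\<forall>\<^sub>F F in finite_subsets_at_top A. dist (sum g F) (infsum g A) < e"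
    using assms(3) unfolding has_sum_def tendsto_iff by blast
  then obtain F where F: "finite F" "F \<subseteq> A" "dist (sum g F) (infsum g A) < e"
    unfolding eventually_finite_subsets_at_top by blast
  show thesis
  proof
    fix D assume D: "finite D" "D \<subseteq> A" "\<And>d. d \<in> D \<Longrightarrow> Max (insert 0 F) < d"
    have "D \<inter> F = {}" using D(3) F(1) by (metis Max_ge disjoint_iff finite.insertI insertCI not_le)
    then have "sum g D + sum g F = sum g (D \<union> F)" using D F by (simp add: sum.union_disjoint)
    also have "\<dots> \<le> infsum g A"
      using D F assms by (intro finite_sum_le_infsum) auto
    finally show "sum g D \<le> e" using F(3) by (auto simp: dist_real_def)
  qed
qed

text \<open>Union bound: a positive d has at most N/d multiples up to N. Bounding the finite subsums
  lets \<open>D\<close> be infinite, since only its members up to N divide anything in the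
  range.\<close>

lemma card_multiples_le:
  fixes c :: real
  assumes "0 \<notin> D" "\<And>E. finite E \<Longrightarrow> E \<subseteq> D \<Longrightarrow> (\<Sum>d\<in>E. 1 / real d) \<le> c"
  shows "real (card {n\<in>{1..N}. \<exists>d\<in>D. d dvd n}) \<le> c * real N"
proof -
  let ?E = "D \<inter> {1..N}"
  have "card {n\<in>{1..N}. \<exists>d\<in>D. d dvd n} \<le> card (\<Union>d\<in>?E. {n\<in>{1..N}. d dvd n})"
  proof (rule card_mono)
    show "{n \<in> {1..N}. \<exists>d\<in>D. d dvd n} \<subseteq> (\<Union>d\<in>?E. {n\<in>{1..N}. d dvd n})"
    proof
      fix n assume "n \<in> {n \<in> {1..N}. \<exists>d\<in>D. d dvd n}"
      then obtain d where d: "n \<in> {1..N}" "d \<in> D" "d dvd n" by auto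
      then have "d \<in> ?E" using assms(1) dvd_imp_le[of d n]
        by (auto simp: Suc_le_eq intro: Nat.gr0I)
      with d show "n \<in> (\<Union>d\<in>?E. {n\<in>{1..N}. d dvd n})" by auto
    qed
  qed auto
  also have "\<dots> \<le> (\<Sum>d\<in>?E. card {n\<in>{1..N}. d dvd n})" by (rule card_UN_le) auto
  finally have "real (card {n\<in>{1..N}. \<exists>d\<in>D. d dvd n}) \<le> (\<Sum>d\<in>?E. real (card {n\<in>{1..N}. d dvd n}))"
    unfolding of_nat_sum[symmetric] of_nat_le_iff .
  also have "\<dots> \<le> (\<Sum>d\<in>?E. real N * (1 / real d))"
  proof (rule sum_mono)
    fix d assume d: "d \<in> ?E"
    have "{n\<in>{1..N}. d dvd n} \<subseteq> (\<lambda>k. d * k) ` {1..N div d}"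
    proof
      fix n assume n: "n \<in> {n\<in>{1..N}. d dvd n}"
      then have "n = d * (n div d)" "1 \<le> n div d" "n div d \<le> N div d"
        using d by (auto simp: div_le_mono dvd_div_eq_0_iff Suc_le_eq intro: Nat.gr0I)
      then show "n \<in> (\<lambda>k. d * k) ` {1..N div d}" by auto
    qed
    then have "card {n\<in>{1..N}. d dvd n} \<le> card {1..N div d}"
      by (rule surj_card_le[rotated]) auto
    then have "real (card {n\<in>{1..N}. d dvd n}) \<le> real (N div d)" by simp
    also have "\<dots> \<le> real N / real d" by (rule of_nat_div_le_of_nat)
    finally show "real (card {n\<in>{1..N}. d dvd n}) \<le> real N * (1 / real d)" by simp
  qed
  also have "\<dots> = (\<Sum>d\<in>?E. 1 / real d) * real N" by (simp add: sum_distrib_left mult.commute)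
  also have "\<dots> \<le> c * real N" using assms(2)[of ?E] by (intro mult_right_mono) auto
  finally show ?thesis .
qed

text \<open>Primes are split off one at a time: as p^2 does not divide n, the cofactor is coprime to
  p and multiplicativity applies. \<open>f 1 = 1\<close> handles the empty product.\<close>

lemma multiplicative_eq_character_on_squarefree:
  assumes f: "f \<in> mult_unit_disc" and \<psi>: "dirichlet_character q \<psi>" and f1: "f 1 = 1"
    and "n > 0" "\<And>p. prime p \<Longrightarrow> p dvd n \<Longrightarrow> f p = \<psi> p \<and> \<not> p\<^sup>2 dvd n"
  shows "f n = \<psi> n"
  using assms(4,5)
proof (induction n rule: less_induct)
  case (less n)
  show ?case
  proof (cases "n = 1")
    case True
    then show ?thesis using f1 dirichlet_character_1[OF \<psi>] by simp
  next
    case False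
    then obtain p where p: "prime p" "p dvd n" using prime_factor_nat by blast
    then obtain m where m: "n = p * m" by auto
    have "\<not> p dvd m" using less.prems(2)[OF p] m by (auto simp: power2_eq_square)
    then have cop: "coprime p m" using p(1) prime_imp_coprime by blast
    have m0: "m > 0" using m less.prems by (auto intro: Nat.gr0I)
    have "m < n" using m m0 p(1) prime_gt_1_nat by simp
    moreover have "f r = \<psi> r \<and> \<not> r\<^sup>2 dvd m" if "prime r" "r dvd m" for r
      using less.prems(2)[OF that(1)] that(2) m by auto
    ultimately have "f m = \<psi> m" using less.IH m0 by blast
    moreover have "f n = f p * f m"
      using f cop m0 prime_gt_0_nat[OF p(1)] unfolding m mult_unit_disc_def by blast
    moreover have "\<psi> n = \<psi> p * \<psi> m" using \<psi> unfolding m dirichlet_character_def by blast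
    ultimately show ?thesis using less.prems(2)[OF p] by simp
  qed
qed

text \<open>
  The approximant splits \<open>n = a b\<close> with \<open>a = gcd n M\<close>, \<open>M = (y!)\<^sup>K\<close>, and is \<open>f(a) \<psi>(b)\<close>. It is
  equal to \<open>f n\<close> unless \<open>n\<close> is divisible by \<open>p\<^sup>K\<^sup>+\<^sup>1\<close> for a \<open>p \<le> y\<close>, by \<open>p\<^sup>2\<close> for a \<open>p > y\<close>, or by
  a \<open>p > y\<close> with \<open>f p \<noteq> \<psi> p\<close>.
\<close>

lemma multiplicative_near_periodic:
  assumes f: "f \<in> mult_unit_disc" and \<psi>: "dirichlet_character q \<psi>" and f1: "f 1 = 1"
    and B: "(\<lambda>p. 1 / real p) summable_on {p. prime p \<and> f p \<noteq> \<psi> p}"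
    and e: "e > 0"
  obtains g r where "r > 0" "\<And>n. g (n + r) = g n" "\<And>n. norm (g n) \<le> 1"
    "\<And>N. real (card {n\<in>{1..N}. f n \<noteq> g n}) \<le> e * real N"
proof -
  let ?B = "{p. prime p \<and> f p \<noteq> \<psi> p}"
  have q: "q > 0" using \<psi> by (simp add: dirichlet_character_def)
  \<comment> \<open>Each of the three kinds of exceptional integers is allowed density at most
    e/3.\<close>
  from e have e3: "e / 3 > 0" by simp
  obtain y1 where y1: "\<And>D. finite D \<Longrightarrow> D \<subseteq> ?B \<Longrightarrow> (\<And>d. d \<in> D \<Longrightarrow> y1 < d) \<Longrightarrow> (\<Sum>p\<in>D. 1 / real p) \<le> e / 3"
    using sum_tail_le[OF B _ e3] by auto
  have "(\<lambda>n. 1 / real n ^ 2) summable_on UNIV"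
    using inverse_power_summable[of 2, where 'a=real]
    by (subst summable_on_UNIV_nonneg_real_iff) (auto simp: field_simps)
  then obtain y2 where y2: "\<And>D. finite D \<Longrightarrow> D \<subseteq> UNIV \<Longrightarrow> (\<And>d. d \<in> D \<Longrightarrow> y2 < d) \<Longrightarrow> (\<Sum>p\<in>D. 1 / real p ^ 2) \<le> e / 3"
    using sum_tail_le[of "\<lambda>n. 1 / real n ^ 2", OF _ _ e3] by (metis zero_le_divide_1_iff zero_le_power2)
  define y where "y = max y1 y2"
  \<comment> \<open>There are at most y + 1 primes up to y, and the multiples of p^(K+1) have
    density at most 2^(-K).\<close>
  have "(\<lambda>K. real (Suc y) * (1/2) ^ K) \<longlonglongrightarrow> real (Suc y) * 0"
    by (intro tendsto_mult_left LIMSEQ_power_zero) auto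
  then have "\<forall>\<^sub>F K in sequentially. real (Suc y) * (1/2) ^ K < e / 3"
    by (rule order_tendstoD) (use e3 in simp)
  then obtain K where K: "real (Suc y) * (1/2) ^ K < e / 3"
    by (auto simp: eventually_sequentially)
  define M :: nat where "M = fact y ^ K"
  have M0: "M > 0" by (simp add: M_def)
  define g where "g n = f (gcd n M) * \<psi> (n div gcd n M)" for n
  define D1 where "D1 = {p\<in>?B. y < p}"
  define D2 where "D2 = (\<lambda>p. p\<^sup>2) ` {p. prime p \<and> y < p}"
  define D3 where "D3 = (\<lambda>p. p ^ Suc K) ` {p. prime p \<and> p \<le> y}"
  have good: "f n = g n" if n: "n > 0" "\<not> (\<exists>d\<in>D1. d dvd n)" "\<not> (\<exists>d\<in>D2. d dvd n)" "\<not> (\<exists>d\<in>D3. d dvd n)" for n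
  proof -
    define a where "a = gcd n M"
    define b where "b = n div a"
    have a0: "a > 0" using n(1) by (simp add: a_def)
    have ab: "n = a * b" by (simp add: a_def b_def)
    have b0: "b > 0" using n(1) ab by (auto intro: Nat.gr0I)
    \<comment> \<open>A prime p \<le> y occurs in \<open>n\<close> at most \<open>K\<close> times,
      and \<open>p ^ K\<close> divides \<open>M\<close>; so the gcd absorbs its whole power and
      leaves none to \<open>b\<close>.\<close>
    have big: "p > y" if p: "prime p" "p dvd b" for p
    proof (rule ccontr)
      assume "\<not> y < p"
      then have le: "p \<le> y" by simp
      then have nd: "\<not> p ^ Suc K dvd n" using n(4) p(1) unfolding D3_def by auto
      have "n \<noteq> 0" using n(1) by simp
      have "p dvd fact y" using le prime_dvd_fact_iff[OF p(1)] by simp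
      then have "p ^ K dvd M" unfolding M_def by (rule dvd_power_same)
      then have pM: "K \<le> multiplicity p M"
        using M0 p(1) by (intro multiplicity_geI) (auto dest: not_prime_unit)
      have pn: "multiplicity p n \<le> K"
        using nd \<open>n \<noteq> 0\<close> by (metis multiplicity_dvd' not_less_eq_eq)
      have "multiplicity p a = min (multiplicity p n) (multiplicity p M)"
        unfolding a_def using multiplicity_gcd[OF \<open>n\<noteq>0\<close>, of M p] M0 p(1) by simp
      then have "multiplicity p a = multiplicity p n" using pM pn by simp
      moreover have "multiplicity p n = multiplicity p a + multiplicity p b"
        unfolding ab using p(1) a0 b0 by (intro prime_elem_multiplicity_mult_distrib) auto
      moreover have "multiplicity p b > 0" using p b0 by (simp add: prime_multiplicity_gt_zero_iff)
      ultimately show False by simp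
    qed
    \<comment> \<open>Primes dividing \<open>a\<close> divide y! and are at most y, whereas those
      dividing \<open>b\<close> exceed y.\<close>
    have "coprime a b"
    proof (rule ccontr)
      assume "\<not> coprime a b"
      then obtain p where p: "prime p" "p dvd a" "p dvd b"
        by (metis coprime_iff_gcd_eq_1 gcd_greatest_iff prime_factor_nat)
      then have "p dvd M" unfolding a_def by simp
      then have "p dvd fact y" unfolding M_def using p(1) prime_dvd_power_nat by blast
      then have "p \<le> y" using prime_dvd_fact_iff[OF p(1)] by simp
      with big[OF p(1,3)] show False by simp
    qed
    then have "f n = f a * f b" using f a0 b0 unfolding ab mult_unit_disc_def by blast
    also have "f b = \<psi> b"
    proof (rule multiplicative_eq_character_on_squarefree[OF f \<psi> f1 b0])
      fix p assume p: "prime p" "p dvd b"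
      note * = big[OF p]
      have "p dvd n" using p ab by simp
      then have "p \<notin> D1" using n(2) by blast
      moreover have "\<not> p\<^sup>2 dvd n" using n(3) p(1) * unfolding D2_def by auto
      ultimately show "f p = \<psi> p \<and> \<not> p\<^sup>2 dvd b" using p(1) * ab unfolding D1_def by auto
    qed
    finally show ?thesis by (simp add: g_def a_def b_def)
  qed
  show thesis
  proof
    \<comment> \<open>Adding \<open>q * M\<close> fixes the gcd with \<open>M\<close> and moves the
      cofactor by \<open>q * (M div gcd n M)\<close>, a multiple of the period of
      \<open>\<psi>\<close>.\<close>
    show "q * M > 0" using q M0 by simp
    show "g (n + q * M) = g n" for n
    proof -
      have "gcd (n + q * M) M = gcd n M"
        using gcd_add_mult[of M q n] by (simp add: gcd.commute add.commute)
      moreover have "(n + q * M) div gcd n M = n div gcd n M + q * (M div gcd n M)"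
        by (simp add: div_plus_div_distrib_dvd_left div_mult_swap)
      ultimately show ?thesis unfolding g_def by (simp add: dirichlet_character_periodic[OF \<psi>])
    qed
    show "norm (g n) \<le> 1" for n
    proof -
      have "gcd n M > 0" using M0 by simp
      then have "norm (f (gcd n M)) \<le> 1" using f unfolding mult_unit_disc_def by blast
      then show ?thesis unfolding g_def norm_mult
        using dirichlet_character_norm_le_1[OF \<psi>] by (intro mult_le_one) auto
    qed
    show "real (card {n\<in>{1..N}. f n \<noteq> g n}) \<le> e * real N" for N
    proof -
      let ?m = "\<lambda>D. {n\<in>{1..N}. \<exists>d\<in>D. d dvd n}"
      have "card {n\<in>{1..N}. f n \<noteq> g n} \<le> card (?m D1 \<union> ?m D2 \<union> ?m D3)"
      proof (rule card_mono)
        show "{n\<in>{1..N}. f n \<noteq> g n} \<subseteq> ?m D1 \<union> ?m D2 \<union> ?m D3"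
        proof
          fix n assume "n \<in> {n\<in>{1..N}. f n \<noteq> g n}"
          then show "n \<in> ?m D1 \<union> ?m D2 \<union> ?m D3" using good[of n] by auto
        qed
      qed auto
      also have "\<dots> \<le> card (?m D1) + card (?m D2) + card (?m D3)"
        by (meson add_le_mono card_Un_le le_refl order_trans)
      finally have "real (card {n\<in>{1..N}. f n \<noteq> g n}) \<le> real (card (?m D1)) + real (card (?m D2)) + real (card (?m D3))"
        by linarith
      also have "real (card (?m D1)) \<le> e / 3 * real N"
      proof (rule card_multiples_le)
        show "(\<Sum>d\<in>E. 1 / real d) \<le> e / 3" if "finite E" "E \<subseteq> D1" for E
          using that by (intro y1) (auto simp: D1_def y_def)
      qed (auto simp: D1_def)
      also have "real (card (?m D2)) \<le> e / 3 * real N"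
      proof (rule card_multiples_le)
        fix E assume E: "finite E" "E \<subseteq> D2"
        obtain C where C: "C \<subseteq> {p. prime p \<and> y < p}" "finite C" "E = (\<lambda>p. p\<^sup>2) ` C"
          using finite_subset_image[OF E[unfolded D2_def]] by auto
        have "(\<Sum>d\<in>E. 1 / real d) = (\<Sum>p\<in>C. 1 / real p ^ 2)"
          unfolding C(3) by (subst sum.reindex) (auto simp: inj_on_def)
        also have "\<dots> \<le> e / 3" using C by (intro y2) (auto simp: y_def)
        finally show "(\<Sum>d\<in>E. 1 / real d) \<le> e / 3" .
      qed (auto simp: D2_def)
      also have "real (card (?m D3)) \<le> e / 3 * real N"
      proof (rule card_multiples_le)
        fix E assume E: "finite E" "E \<subseteq> D3"
        have "1 / real d \<le> (1/2) ^ K" if "d \<in> E" for d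
        proof -
          obtain p where p: "prime p" "d = p ^ Suc K" using \<open>d \<in> E\<close> E unfolding D3_def by auto
          have "2 ^ K \<le> (2::real) ^ Suc K" by simp
          also have "\<dots> \<le> real p ^ Suc K" using prime_ge_2_nat[OF p(1)] by (intro power_mono) auto
          finally have "1 / real d \<le> 1 / 2 ^ K" using p by (intro divide_left_mono) (auto simp: prime_gt_0_nat)
          then show ?thesis by (simp add: power_one_over)
        qed
        then have "(\<Sum>d\<in>E. 1 / real d) \<le> real (card E) * (1/2)^K" by (intro sum_bounded_above) auto
        also have "card E \<le> Suc y"
        proof -
          have "card E \<le> card D3" using E(2) by (intro card_mono) (auto simp: D3_def)
          also have "\<dots> \<le> card {p. prime p \<and> p \<le> y}" unfolding D3_def by (rule card_image_le) auto
          also have "\<dots> \<le> card {..y}" by (rule card_mono) auto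
          finally show ?thesis by simp
        qed
        then have "real (card E) * (1/2)^K \<le> real (Suc y) * (1/2)^K" by (intro mult_right_mono) auto
        finally show "(\<Sum>d\<in>E. 1 / real d) \<le> e / 3" using K by linarith
      qed (auto simp: D3_def)
      finally show ?thesis by (simp add: field_simps)
    qed
  qed
qed

section \<open>Pretending to be a twisted character\<close>

text \<open>Among the integers free of the primes in \<open>P\<close>, the multiples of a further
  prime q are exactly q times the same set. They carry the fraction \<open>a q\<close> of the sum,
  and removing them multiplies it by \<open>1 - a q\<close>.\<close>

lemma sieve_identity:
  fixes a :: "nat \<Rightarrow> 'a::{real_normed_field, banach}"
  assumes mult: "\<And>m n. a (m * n) = a m * a n" and sum: "(\<lambda>n. norm (a n)) summable_on UNIV"
    and "finite P" "\<And>p. p \<in> P \<Longrightarrow> prime p"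
  shows "(\<Prod>p\<in>P. 1 - a p) * infsum a UNIV = infsum a {n. \<forall>p\<in>P. \<not> p dvd n}"
  using assms(3,4)
proof (induction P)
  case (insert q P)
  let ?T = "{n. \<forall>p\<in>P. \<not> p dvd n}"
  have q: "prime q" using insert.prems by simp
  have summ: "a summable_on S" for S
    by (rule abs_summable_summable, rule summable_on_subset_banach[OF sum]) simp
  have eq: "{n. \<forall>p\<in>insert q P. \<not> p dvd n} = ?T - (\<lambda>n. q * n) ` ?T"
  proof (intro equalityI subsetI)
    fix n assume "n \<in> ?T - (\<lambda>n. q * n) ` ?T"
    then have n: "n \<in> ?T" "n \<notin> (\<lambda>n. q * n) ` ?T" by auto
    have "\<not> q dvd n"
    proof
      assume "q dvd n"
      then obtain m where "n = q * m" by auto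
      moreover from this have "m \<in> ?T" using n(1) by auto
      ultimately show False using n(2) by blast
    qed
    with n show "n \<in> {n. \<forall>p\<in>insert q P. \<not> p dvd n}" by auto
  qed auto
  have sub: "(\<lambda>n. q * n) ` ?T \<subseteq> ?T"
  proof
    fix x assume "x \<in> (\<lambda>n. q * n) ` ?T"
    then obtain n where n: "x = q * n" "\<forall>p\<in>P. \<not> p dvd n" by auto
    have "\<not> p dvd x" if "p \<in> P" for p
    proof
      assume "p dvd x"
      moreover have pp: "prime p" using insert.prems that by simp
      ultimately have "p dvd q" using n that prime_dvd_mult_iff by auto
      then have "p = q" using pp q primes_dvd_imp_eq by blast
      then show False using that insert.hyps by simp
    qed
    then show "x \<in> ?T" by simp
  qed
  have "infsum a {n. \<forall>p\<in>insert q P. \<not> p dvd n} = infsum a ?T - infsum a ((\<lambda>n. q * n) ` ?T)"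
    unfolding eq by (intro infsum_Diff summ sub)
  also have "infsum a ((\<lambda>n. q * n) ` ?T) = infsum (a \<circ> (\<lambda>n. q * n)) ?T"
    using prime_gt_0_nat[OF q] by (intro infsum_reindex) (auto simp: inj_on_def)
  also have "\<dots> = a q * infsum a ?T"
    by (simp add: o_def mult infsum_cmult_right summ)
  finally show ?case using insert by (simp add: algebra_simps)
qed simp

text \<open>The Euler product, stated as a product close to 1 and not as a formula for the sum:
  after sieving by the primes up to x, apart from 1 only integers above x matter, and they
  contribute a tail of an absolutely convergent series.\<close>

lemma sieve_limit:
  fixes a :: "nat \<Rightarrow> 'a::{real_normed_field, banach}"
  assumes mult: "\<And>m n. a (m * n) = a m * a n" and sum: "(\<lambda>n. norm (a n)) summable_on UNIV"
    and a1: "a 1 = 1" and a0: "a 0 = 0" and e: "e > 0"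
  obtains y where
    "\<And>x. y \<le> x \<Longrightarrow> norm ((\<Prod>p | prime p \<and> p \<le> x. 1 - a p) * infsum a UNIV - 1) \<le> e"
proof -
  have summ: "(\<lambda>n. norm (a n)) summable_on S" "a summable_on S" for S
  proof -
    show *: "(\<lambda>n. norm (a n)) summable_on S" by (rule summable_on_subset_banach[OF sum]) simp
    show "a summable_on S" by (rule abs_summable_summable[OF *])
  qed
  obtain y where y: "\<And>D. finite D \<Longrightarrow> (\<And>d. d \<in> D \<Longrightarrow> y < d) \<Longrightarrow> (\<Sum>n\<in>D. norm (a n)) \<le> e"
    using sum_tail_le[OF sum _ e] by auto
  show thesis
  proof
    fix x assume x: "y \<le> x"
    let ?T = "{n. \<forall>p\<in>{p. prime p \<and> p \<le> x}. \<not> p dvd n}"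
    have fin: "finite {p. prime p \<and> p \<le> x}" by (rule finite_subset[of _ "{..x}"]) auto
    have "(\<Prod>p | prime p \<and> p \<le> x. 1 - a p) * infsum a UNIV = infsum a ?T"
      by (rule sieve_identity[OF mult sum fin]) auto
    \<comment> \<open>If there is no prime up to x, the integer 0 survives the sieve;
      \<open>a 0 = 0\<close> removes it.\<close>
    also have "\<dots> = infsum a (insert 1 (?T - {0,1}))"
      using a0 by (intro infsum_cong_neutral) auto
    also have "\<dots> = 1 + infsum a (?T - {0,1})"
      using summ a1 by (subst infsum_insert) auto
    finally have "norm ((\<Prod>p | prime p \<and> p \<le> x. 1 - a p) * infsum a UNIV - 1) = norm (infsum a (?T - {0,1}))"
      by simp
    also have "\<dots> \<le> infsum (\<lambda>n. norm (a n)) (?T - {0,1})" by (intro norm_infsum_bound summ)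
    also have "\<dots> \<le> e"
    proof (rule infsum_le_finite_sums[OF summ(1)])
      fix F assume F: "finite F" "F \<subseteq> ?T - {0,1}"
      have "y < n" if "n \<in> F" for n
      proof -
        have n: "n \<in> ?T" "n \<noteq> 0" "n \<noteq> 1" using F that by auto
        then obtain p where p: "prime p" "p dvd n" using prime_factor_nat by blast
        have "x < p"
        proof (rule ccontr)
          assume "\<not> x < p"
          with n(1) p show False by simp
        qed
        also have "p \<le> n" using p n by (simp add: dvd_imp_le)
        finally show ?thesis using x by simp
      qed
      then show "(\<Sum>n\<in>F. norm (a n)) \<le> e" using F by (intro y) auto
    qed
    finally show "norm ((\<Prod>p | prime p \<and> p \<le> x. 1 - a p) * infsum a UNIV - 1) \<le> e" .
  qed
qed

section \<open>The zeta series just to the right of 1 + i u\<close>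

lemma norm_powr_summable_on:
  assumes "Re s > 1"
  shows "(\<lambda>n. norm (of_nat n powr (- s) :: complex)) summable_on UNIV"
proof -
  have "norm (of_nat n powr (- s) :: complex) = real n powr (- Re s)" for n
    by (cases "n = 0") (auto simp: norm_powr_real_powr)
  then show ?thesis
    using assms by (simp add: summable_on_UNIV_nonneg_real_iff summable_real_powr_iff)
qed

text \<open>Mean value inequality on a segment of the real axis inside the complex plane: the
  derivative -s z^(-s-1) has modulus at most |s| / n^2 there, because Re s \<ge> 1.\<close>

lemma powr_minus_diff_bound:
  fixes s :: complex
  assumes n: "n > 0" and s: "Re s \<ge> 1" and x: "real n \<le> x" "x \<le> real n + 1"
  shows "norm (of_real x powr (- s) - of_nat n powr (- s)) \<le> norm s / real n ^ 2"
proof -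
  let ?S = "complex_of_real ` {real n .. real n + 1}"
  have S: "convex ?S"
    by (rule convex_linear_image[OF bounded_linear.linear[OF bounded_linear_of_real]]) simp
  have "norm (of_real x powr (- s) - of_real (real n) powr (- s))
      \<le> norm s / real n ^ 2 * norm (of_real x - complex_of_real (real n))"
  proof (rule field_differentiable_bound[OF S, where f' = "\<lambda>z. - s * z powr (- s - 1)"])
    fix z assume "z \<in> ?S"
    then obtain r where r: "z = of_real r" "real n \<le> r" by auto
    have r0: "r > 0" using n r by simp
    show "((\<lambda>z. z powr - s) has_field_derivative - s * z powr (- s - 1)) (at z within ?S)"
      by (rule has_field_derivative_at_within, rule has_field_derivative_powr)
        (use r0 r in \<open>auto simp: complex_nonpos_Reals_iff\<close>)
    have "r powr (- Re s - 1) \<le> r powr (-2)" using n r s by (intro powr_mono) auto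
    also have "\<dots> = 1 / r ^ 2" using r0 by (simp add: powr_neg_numeral)
    also have "\<dots> \<le> 1 / real n ^ 2" using r n by (intro divide_left_mono power_mono) auto
    finally have "norm s * r powr (- Re s - 1) \<le> norm s * (1 / real n ^ 2)"
      by (intro mult_left_mono) auto
    then show "norm (- s * z powr (- s - 1)) \<le> norm s / real n ^ 2"
      using r0 r by (simp add: norm_mult norm_powr_real_powr)
  next
    show "complex_of_real x \<in> ?S" using x by auto
    show "complex_of_real (real n) \<in> ?S" by (intro imageI) simp
  qed
  also have "\<dots> \<le> norm s / real n ^ 2 * 1"
  proof (rule mult_left_mono)
    have "norm (of_real x - complex_of_real (real n)) = \<bar>x - real n\<bar>"
      using norm_of_real[of "x - real n", where 'a=complex] by simp
    then show "norm (of_real x - complex_of_real (real n)) \<le> 1" using x by linarith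
  qed simp
  finally show ?thesis by simp
qed

text \<open>This compares a term with the integral of z^(-s) over [n, n+1]. \<open>F\<close> is an
  antiderivative, and subtracting the linear function z n^(-s) leaves a function whose derivative is
  the difference bounded in \<open>powr_minus_diff_bound\<close>.\<close>

lemma powr_antiderivative_diff_bound:
  fixes s :: complex
  assumes n: "n > 0" and s: "Re s \<ge> 1" "s \<noteq> 1"
  defines "F \<equiv> \<lambda>z. z powr (1 - s) / (1 - s)"
  shows "norm (F (of_nat (Suc n)) - F (of_nat n) - of_nat n powr (- s)) \<le> norm s / real n ^ 2"
proof -
  let ?S = "complex_of_real ` {real n .. real n + 1}"
  have S: "convex ?S"
    by (rule convex_linear_image[OF bounded_linear.linear[OF bounded_linear_of_real]]) simp
  define G where "G = (\<lambda>z. F z - z * of_nat n powr (- s))"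
  have "norm (G (of_real (real n + 1)) - G (of_real (real n)))
      \<le> norm s / real n ^ 2 * norm (complex_of_real (real n + 1) - complex_of_real (real n))"
  proof (rule field_differentiable_bound[OF S, where f' = "\<lambda>z. z powr (- s) - of_nat n powr (- s)"])
    fix z assume "z \<in> ?S"
    then obtain r where r: "z = of_real r" "real n \<le> r" "r \<le> real n + 1" by auto
    have r0: "r > 0" using n r by simp
    have "((\<lambda>z. z powr (1 - s)) has_field_derivative (1 - s) * z powr (1 - s - 1)) (at z within ?S)"
      by (rule has_field_derivative_at_within, rule has_field_derivative_powr)
        (use r0 r in \<open>auto simp: complex_nonpos_Reals_iff\<close>)
    from DERIV_cdivide[OF this, of "1 - s"]
    have "(F has_field_derivative z powr (- s)) (at z within ?S)"
      using s by (simp add: F_def)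
    from DERIV_diff[OF this DERIV_cmult_right[OF DERIV_ident, of "of_nat n powr (- s)"]]
    show "(G has_field_derivative z powr (- s) - of_nat n powr (- s)) (at z within ?S)"
      unfolding G_def by simp
    show "norm (z powr (- s) - of_nat n powr (- s)) \<le> norm s / real n ^ 2"
      using powr_minus_diff_bound[OF n s(1) r(2,3)] r(1) by simp
  next
    show "complex_of_real (real n + 1) \<in> ?S" by (intro imageI) simp
    show "complex_of_real (real n) \<in> ?S" by (intro imageI) simp
  qed
  moreover have "G (of_real (real n + 1)) - G (of_real (real n))
      = F (of_nat (Suc n)) - F (of_nat n) - of_nat n powr (- s)"
    by (simp add: G_def ring_distribs add.commute)
  ultimately show ?thesis by simp
qed

text \<open>The terms are compared with telescoping increments of z^(1-s)/(1-s). As |1-s| \<ge> |u|,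
  this antiderivative stays bounded when \<sigma> tends to 0, and the errors add up to at most |s|
  times the sum of 1/n^2.\<close>

lemma zeta_bounded_near_one_line:
  fixes u :: real
  assumes u: "u \<noteq> 0"
  obtains C where "C > 0" "\<And>\<sigma>. 0 < \<sigma> \<Longrightarrow> \<sigma> \<le> 1 \<Longrightarrow>
    norm (\<Sum>\<^sub>\<infinity>n. of_nat n powr (- Complex (1 + \<sigma>) u) :: complex) \<le> C"
proof -
  define c where "c = (\<Sum>n. 1 / real (Suc n) ^ 2)"
  have summ: "summable (\<lambda>n. 1 / real (Suc n) ^ 2)"
    using inverse_power_summable[of 2, where 'a=real] by (subst summable_Suc_iff) (auto simp: field_simps)
  have c0: "c \<ge> 0" unfolding c_def by (intro suminf_nonneg summ) auto
  \<comment> \<open>The two ends of the telescoping sum give 2/|u|, and 2 + |u| bounds |s| for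
    \<sigma> \<le> 1.\<close>
  define C where "C = 2 / \<bar>u\<bar> + (2 + \<bar>u\<bar>) * c"
  show thesis
  proof
    show "C > 0" using u c0 by (auto simp: C_def intro!: add_pos_nonneg)
    fix \<sigma> :: real assume \<sigma>: "0 < \<sigma>" "\<sigma> \<le> 1"
    define s where "s = Complex (1 + \<sigma>) u"
    have s: "Re s > 1" "s \<noteq> 1" "Re s = 1 + \<sigma>" using \<sigma> by (auto simp: s_def complex_eq_iff)
    have ns: "norm s \<le> 2 + \<bar>u\<bar>" using cmod_le[of s] \<sigma> by (simp add: s_def)
    define a :: "nat \<Rightarrow> complex" where "a = (\<lambda>n. of_nat n powr (- s))"
    define F where "F = (\<lambda>z. z powr (1 - s) / (1 - s))"
    have F: "norm (F (of_nat n)) \<le> 1 / \<bar>u\<bar>" if "n > 0" for n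
    proof -
      have "real n powr (- \<sigma>) \<le> 1" using powr_mono[of "-\<sigma>" 0 "real n"] that \<sigma> by simp
      moreover have "\<bar>u\<bar> \<le> norm (1 - s)" using abs_Im_le_cmod[of "1 - s"] by (simp add: s_def)
      ultimately have "real n powr (- \<sigma>) / norm (1 - s) \<le> 1 / \<bar>u\<bar>" using u by (intro frac_le) auto
      then show ?thesis using that s by (simp add: F_def norm_divide norm_powr_real_powr)
    qed
    have part: "norm (\<Sum>n<N. a (Suc n)) \<le> C" for N
    proof -
      have "(\<Sum>n<N. a (Suc n)) = (\<Sum>n<N. F (of_nat (Suc (Suc n))) - F (of_nat (Suc n)))
          - (\<Sum>n<N. F (of_nat (Suc (Suc n))) - F (of_nat (Suc n)) - a (Suc n))"
        by (simp add: sum_subtractf)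
      also have "(\<Sum>n<N. F (of_nat (Suc (Suc n))) - F (of_nat (Suc n))) = F (of_nat (Suc N)) - F (of_nat 1)"
        using sum_lessThan_telescope[of "\<lambda>n. F (of_nat (Suc n))" N] by simp
      finally have "norm (\<Sum>n<N. a (Suc n)) \<le> norm (F (of_nat (Suc N)) - F (of_nat 1))
          + norm (\<Sum>n<N. F (of_nat (Suc (Suc n))) - F (of_nat (Suc n)) - a (Suc n))"
        by (simp only: norm_triangle_ineq4)
      also have "norm (F (of_nat (Suc N)) - F (of_nat 1)) \<le> 1 / \<bar>u\<bar> + 1 / \<bar>u\<bar>"
        by (rule order_trans[OF norm_triangle_ineq4 add_mono[OF F F]]) auto
      also have "norm (\<Sum>n<N. F (of_nat (Suc (Suc n))) - F (of_nat (Suc n)) - a (Suc n))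
          \<le> (\<Sum>n<N. norm s * (1 / real (Suc n) ^ 2))"
      proof (rule sum_norm_le)
        fix n
        show "norm (F (of_nat (Suc (Suc n))) - F (of_nat (Suc n)) - a (Suc n)) \<le> norm s * (1 / real (Suc n) ^ 2)"
          using powr_antiderivative_diff_bound[of "Suc n" s] s unfolding a_def F_def by simp
      qed
      also have "\<dots> = norm s * (\<Sum>n<N. 1 / real (Suc n) ^ 2)" by (simp add: sum_distrib_left)
      also have "\<dots> \<le> (2 + \<bar>u\<bar>) * c"
      proof (rule mult_mono[OF ns])
        show "(\<Sum>n<N. 1 / real (Suc n) ^ 2) \<le> c"
          unfolding c_def by (rule sum_le_suminf[OF summ]) auto
      qed (auto intro: sum_nonneg)
      finally show ?thesis by (simp add: C_def)
    qed
    have "a summable_on UNIV"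
      unfolding a_def by (rule abs_summable_summable[OF norm_powr_summable_on[OF s(1)]])
    then have "(a has_sum infsum a UNIV) UNIV" by simp
    then have "a sums infsum a UNIV" by (rule has_sum_imp_sums)
    then have "(\<lambda>n. a (Suc n)) sums (infsum a UNIV - a 0)" by (simp add: sums_Suc_iff)
    \<comment> \<open>The series runs over all naturals, but \<open>0 powr z\<close> is 0, so the
      term at 0 vanishes.\<close>
    then have "(\<lambda>N. \<Sum>n<N. a (Suc n)) \<longlonglongrightarrow> infsum a UNIV" by (simp add: a_def sums_def)
    then have "norm (infsum a UNIV) \<le> C"
      by (rule Lim_norm_ubound[rotated]) (auto simp: part)
    then show "norm (\<Sum>\<^sub>\<infinity>n. of_nat n powr (- Complex (1 + \<sigma>) u) :: complex) \<le> C"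
      unfolding a_def s_def .
  qed
qed

section \<open>Sums over primes near s = 1 and s = 1 + i u\<close>

lemma finite_primes_le: "finite {p::nat. prime p \<and> p \<le> x}"
  by (rule finite_subset[of _ "{..x}"]) auto

lemma powr_minus_completely_multiplicative:
  "of_nat (m * n) powr (- s) = (of_nat m powr (- s) * of_nat n powr (- s) :: complex)"
  using powr_times_real[of "of_nat m" "of_nat n" "- s"] by simp

text \<open>The partial products of 1 - p^(-s), multiplied by zeta(s), tend to 1; so an upper bound
  for |zeta(s)| bounds them from below. Bounding each factor by an exponential then limits the real
  part of the prime sum from above. The bound is uniform in \<sigma>; only the threshold
  \<open>y\<close> may depend on it.\<close>

lemma sum_primes_powr_upper_bound:
  fixes u :: real
  assumes u: "u \<noteq> 0"
  obtains C where "\<And>\<sigma>. 0 < \<sigma> \<Longrightarrow> \<sigma> \<le> 1 \<Longrightarrow> \<exists>y. \<forall>x\<ge>y.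
    Re (\<Sum>p | prime p \<and> p \<le> x. of_nat p powr (- Complex (1 + \<sigma>) u)) \<le> C"
proof -
  obtain C where C: "C > 0" "\<And>\<sigma>. 0 < \<sigma> \<Longrightarrow> \<sigma> \<le> 1 \<Longrightarrow>
    norm (\<Sum>\<^sub>\<infinity>n. of_nat n powr (- Complex (1 + \<sigma>) u) :: complex) \<le> C"
    using zeta_bounded_near_one_line[OF u] by blast
  have summ: "summable (\<lambda>n. 1 / real n ^ 2)"
    using inverse_power_summable[of 2, where 'a=real] by (simp add: field_simps)
  define c where "c = (\<Sum>n. 1 / real n ^ 2)"
  show thesis
  proof
    fix \<sigma> :: real assume \<sigma>: "0 < \<sigma>" "\<sigma> \<le> 1"
    define s where "s = Complex (1 + \<sigma>) u"
    have s: "Re s > 1" using \<sigma> by (simp add: s_def)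
    define a :: "nat \<Rightarrow> complex" where "a = (\<lambda>n. of_nat n powr (- s))"
    define Z where "Z = infsum a UNIV"
    obtain y where y: "\<And>x. y \<le> x \<Longrightarrow> norm ((\<Prod>p | prime p \<and> p \<le> x. 1 - a p) * Z - 1) \<le> 1/2"
    proof (rule sieve_limit[of a "1/2"])
      show "a (m * n) = a m * a n" for m n unfolding a_def by (rule powr_minus_completely_multiplicative)
      show "(\<lambda>n. norm (a n)) summable_on UNIV" unfolding a_def by (rule norm_powr_summable_on[OF s])
    qed (auto simp: a_def Z_def)
    show "\<exists>y. \<forall>x\<ge>y. Re (\<Sum>p | prime p \<and> p \<le> x. of_nat p powr (- Complex (1 + \<sigma>) u))
      \<le> ln (2 * C) + c / 2"
    proof (intro exI allI impI)
      fix x assume x: "x \<ge> y"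
      let ?P = "{p. prime p \<and> p \<le> x}"
      define R where "R = Re (\<Sum>p\<in>?P. a p)"
      \<comment> \<open>Squaring avoids complex logarithms: |1 - z|^2 = 1 + (-2 Re z + |z|^2), and 1
        + x \<le> exp x.\<close>
      have factor: "norm (1 - z) \<le> exp (- Re z + norm z ^ 2 / 2)" for z :: complex
      proof -
        have "norm (1 - z) ^ 2 = 1 + (- 2 * Re z + norm z ^ 2)"
          unfolding cmod_power2 by (simp add: power2_eq_square algebra_simps)
        also have "\<dots> \<le> exp (- 2 * Re z + norm z ^ 2)" by (rule exp_ge_add_one_self)
        also have "\<dots> = exp (- Re z + norm z ^ 2 / 2) ^ 2"
          by (simp flip: exp_of_nat_mult)
        finally show ?thesis by (rule power2_le_imp_le) simp
      qed
      have "1 = norm (1 :: complex)" by simp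
      also have "\<dots> \<le> norm ((\<Prod>p\<in>?P. 1 - a p) * Z) + norm ((\<Prod>p\<in>?P. 1 - a p) * Z - 1)"
        by (metis add.commute norm_minus_commute norm_triangle_sub)
      also have "norm ((\<Prod>p\<in>?P. 1 - a p) * Z - 1) \<le> 1/2" by (rule y[OF x])
      finally have "1/2 \<le> norm (\<Prod>p\<in>?P. 1 - a p) * norm Z" by (simp add: norm_mult)
      also have "\<dots> \<le> exp (- R + c / 2) * C"
      proof (rule mult_mono)
        have "norm (\<Prod>p\<in>?P. 1 - a p) \<le> (\<Prod>p\<in>?P. exp (- Re (a p) + norm (a p) ^ 2 / 2))"
          unfolding prod_norm[symmetric] by (intro prod_mono) (use factor in auto)
        also have "\<dots> = exp (\<Sum>p\<in>?P. - Re (a p) + norm (a p) ^ 2 / 2)"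
          by (rule exp_sum[symmetric, OF finite_primes_le])
        also have "(\<Sum>p\<in>?P. - Re (a p) + norm (a p) ^ 2 / 2) = - R + (\<Sum>p\<in>?P. norm (a p) ^ 2) / 2"
          by (simp add: R_def sum_subtractf sum_divide_distrib)
        also have "(\<Sum>p\<in>?P. norm (a p) ^ 2) \<le> (\<Sum>p\<in>?P. 1 / real p ^ 2)"
        proof (rule sum_mono)
          fix p assume "p \<in> ?P"
          then have p: "real p \<ge> 1" using prime_ge_1_nat[of p] by simp
          then have "norm (a p) = real p powr (- Re s)" by (simp add: a_def norm_powr_real_powr)
          also have "\<dots> \<le> real p powr (-1)" using p s by (intro powr_mono) auto
          finally have "norm (a p) ^ 2 \<le> (real p powr (-1)) ^ 2" by (intro power_mono) auto
          then show "norm (a p) ^ 2 \<le> 1 / real p ^ 2" using p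
            by (simp add: powr_minus_divide power_one_over)
        qed
        also have "\<dots> \<le> c" unfolding c_def by (rule sum_le_suminf[OF summ finite_primes_le]) auto
        finally show "norm (\<Prod>p\<in>?P. 1 - a p) \<le> exp (- R + c / 2)" by simp
        show "norm Z \<le> C" using C(2)[OF \<sigma>] unfolding Z_def a_def s_def .
      qed auto
      finally have "exp R * (1/2) \<le> exp R * (exp (- R + c / 2) * C)" by (intro mult_left_mono) auto
      also have "\<dots> = exp (R + (- R + c / 2)) * C" by (simp only: exp_add mult.assoc)
      finally have "exp R \<le> 2 * C * exp (c / 2)" by (simp add: mult_ac)
      also have "\<dots> = exp (ln (2 * C) + c / 2)" using C(1) by (simp add: exp_add)
      finally show "Re (\<Sum>p\<in>?P. of_nat p powr (- Complex (1 + \<sigma>) u)) \<le> ln (2 * C) + c / 2"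
        by (simp add: R_def a_def s_def)
    qed
  qed
qed

text \<open>Euler's argument: if these sums were eventually at most C for every \<sigma>, the
  products of 1 - p^(-1-\<sigma>) would be at least exp(-2C), so zeta(1+\<sigma>) would stay bounded
  as \<sigma> tends to 0, and with it the harmonic sums.\<close>

lemma sum_primes_powr_unbounded:
  fixes C :: real
  obtains \<sigma> where "0 < \<sigma>" "\<sigma> \<le> 1"
    "\<And>y. \<exists>x\<ge>y. (\<Sum>p | prime p \<and> p \<le> x. real p powr (- (1 + \<sigma>))) > C"
proof (rule ccontr)
  note unbounded = that
  assume neg: "\<not> thesis"
  have bdd: "\<exists>y. \<forall>x\<ge>y. (\<Sum>p | prime p \<and> p \<le> x. real p powr (- (1 + \<sigma>))) \<le> C"
    if \<sigma>: "0 < \<sigma>" "\<sigma> \<le> 1" for \<sigma>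
  proof (rule ccontr)
    assume "\<not> ?thesis"
    then have "\<exists>x\<ge>y. (\<Sum>p | prime p \<and> p \<le> x. real p powr (- (1 + \<sigma>))) > C" for y
      by (simp add: not_le)
    with neg unbounded[OF \<sigma>] show False by blast
  qed
  \<comment> \<open>The factor 3/2 comes from the sieve with error 1/2, and exp(2C) inverts the
    lower bound for the product.\<close>
  define K where "K = 3/2 * exp (2 * C)"
  have part: "(\<Sum>n\<in>{1..N}. real n powr (- (1 + \<sigma>))) \<le> K" if \<sigma>: "0 < \<sigma>" "\<sigma> \<le> 1" for \<sigma> N
  proof -
    define a where "a = (\<lambda>n. real n powr (- (1 + \<sigma>)))"
    have a0: "a n \<ge> 0" for n by (simp add: a_def)
    define Z where "Z = infsum a UNIV"
    have summ: "(\<lambda>n. norm (a n)) summable_on UNIV"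
      unfolding a_def using \<sigma> by (simp add: summable_on_UNIV_nonneg_real_iff summable_real_powr_iff)
    obtain y where y: "\<And>x. y \<le> x \<Longrightarrow> norm ((\<Prod>p | prime p \<and> p \<le> x. 1 - a p) * Z - 1) \<le> 1/2"
    proof (rule sieve_limit[of a "1/2"])
      show "a (m * n) = a m * a n" for m n unfolding a_def by (simp add: powr_mult)
    qed (use summ in \<open>auto simp: a_def Z_def\<close>)
    obtain y' where y': "\<And>x. x \<ge> y' \<Longrightarrow> (\<Sum>p | prime p \<and> p \<le> x. a p) \<le> C"
      using bdd[OF \<sigma>] unfolding a_def by blast
    define x where "x = max y y'"
    let ?P = "{p. prime p \<and> p \<le> x}"
    have "exp (- 2 * C) \<le> exp (\<Sum>p\<in>?P. - 2 * a p)"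
      using y'[of x] by (simp add: x_def sum_distrib_left[symmetric] sum_negf)
    also have "\<dots> = (\<Prod>p\<in>?P. exp (- 2 * a p))" by (rule exp_sum[OF finite_primes_le])
    also have "\<dots> \<le> (\<Prod>p\<in>?P. 1 - a p)"
    proof (rule prod_mono)
      fix p assume "p \<in> ?P"
      then have p: "real p \<ge> 2" using prime_ge_2_nat[of p] by simp
      have "a p \<le> real p powr (-1)" unfolding a_def using p \<sigma> by (intro powr_mono) auto
      also have "\<dots> \<le> 1/2" using p by (simp add: powr_minus_divide)
      finally have *: "a p \<le> 1/2" .
      \<comment> \<open>The product equals 1 + a (1 - 2a), which is at least 1 for 0 \<le> a \<le>
        1/2; this yields 1 - a \<ge> exp(-2a).\<close>
      have "1 \<le> (1 - a p) * (1 + 2 * a p)"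
        using mult_nonneg_nonneg[OF a0[of p], of "1 - 2 * a p"] * by (simp add: algebra_simps)
      also have "\<dots> \<le> (1 - a p) * exp (2 * a p)"
        using * by (intro mult_left_mono exp_ge_add_one_self) auto
      finally show "0 \<le> exp (- 2 * a p) \<and> exp (- 2 * a p) \<le> 1 - a p"
        by (simp add: exp_minus field_simps)
    qed
    finally have "exp (- 2 * C) * Z \<le> (\<Prod>p\<in>?P. 1 - a p) * Z"
      using a0 by (intro mult_right_mono) (auto simp: Z_def intro: infsum_nonneg)
    also have "\<dots> \<le> 3/2"
    proof -
      have "\<bar>(\<Prod>p\<in>?P. 1 - a p) * Z - 1\<bar> \<le> 1/2" using y[of x] by (simp add: x_def)
      then show ?thesis by linarith
    qed
    finally have "Z \<le> K" by (simp add: K_def exp_minus field_simps)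
    moreover have "(\<Sum>n\<in>{1..N}. a n) \<le> Z"
      unfolding Z_def using summ a0 by (intro finite_sum_le_infsum) auto
    ultimately show ?thesis by (simp add: a_def)
  qed
  \<comment> \<open>For fixed N the sum in \<open>part\<close> is finite, so \<sigma> may tend to 0
    from the right in it.\<close>
  have "(\<Sum>n\<in>{1..N}. 1 / real n) \<le> K" for N
  proof (rule tendsto_upperbound)
    have "((\<lambda>\<sigma>. \<Sum>n\<in>{1..N}. real n powr (- (1 + \<sigma>))) \<longlongrightarrow> (\<Sum>n\<in>{1..N}. real n powr (- (1 + 0)))) (at_right 0)"
      by (intro tendsto_intros) auto
    also have "(\<Sum>n\<in>{1..N}. real n powr (- (1 + 0))) = (\<Sum>n\<in>{1..N}. 1 / real n)"
      by (intro sum.cong) (auto simp: powr_minus_divide)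
    finally show "((\<lambda>\<sigma>. \<Sum>n\<in>{1..N}. real n powr (- (1 + \<sigma>))) \<longlongrightarrow> (\<Sum>n\<in>{1..N}. 1 / real n)) (at_right 0)" .
    have "\<forall>\<^sub>F \<sigma> :: real in at_right 0. \<sigma> \<in> {0<..<1}"
      by (rule eventually_at_right_real) simp
    then show "\<forall>\<^sub>F \<sigma> in at_right 0. (\<Sum>n\<in>{1..N}. real n powr (- (1 + \<sigma>))) \<le> K"
    proof eventually_elim
      case (elim \<sigma>)
      then show ?case using part[of \<sigma> N] by simp
    qed
  qed simp
  then have "harm N \<le> K" for N by (simp add: harm_def inverse_eq_divide)
  moreover have "\<forall>\<^sub>F N in sequentially. harm N > K"
    using harm_at_top by (simp add: filterlim_at_top_dense)
  ultimately show False by (auto simp: eventually_sequentially not_less[symmetric])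
qed

section \<open>Excluding a nonzero twist\<close>

text \<open>Dirichlet approximation of the arguments divided by 2 pi: if q \<theta> is within 1/N of
  an integer, then the q-th power is within 2 pi / N of 1.\<close>

lemma powers_simultaneously_near_1:
  fixes W :: "complex set"
  assumes "finite W" "\<And>w. w \<in> W \<Longrightarrow> norm w = 1" "e > 0"
  shows "\<exists>k>0. \<forall>w\<in>W. norm (w ^ k - 1) \<le> e"
proof -
  obtain h where h: "bij_betw h {..<card W} W"
    using ex_bij_betw_nat_finite[OF assms(1)] by (auto simp: atLeast0LessThan)
  obtain N :: nat where N: "real N > 2 * pi / e" "N > 0"
    using reals_Archimedean2[of "max 0 (2 * pi / e)"] by auto
  define \<theta> where "\<theta> i = Arg (h i) / (2 * pi)" for i
  obtain q p where q: "0 < q" "\<And>i. i < card W \<Longrightarrow> \<bar>of_int q * \<theta> i - of_int (p i)\<bar> < 1 / N"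
    using Dirichlet_approx_simult[OF N(2), of "card W" \<theta>] by metis
  show ?thesis
  proof (intro exI conjI ballI)
    show "nat q > 0" using q by simp
    fix w assume w: "w \<in> W"
    then obtain i where i: "i < card W" "w = h i" using h by (auto simp: bij_betw_def)
    define t where "t = 2 * pi * (of_int q * \<theta> i - of_int (p i))"
    have "w \<noteq> 0" using assms(2)[OF w] by auto
    then have "w = cis (2 * pi * \<theta> i)" using cis_Arg[of w] assms(2)[OF w] i by (simp add: \<theta>_def sgn_eq)
    then have "w ^ nat q = cis (real (nat q) * (2 * pi * \<theta> i))" by (simp only: Complex.DeMoivre)
    also have "real (nat q) = of_int q" using q(1) by simp
    also have "cis (of_int q * (2 * pi * \<theta> i)) = cis t * cis (2 * pi * of_int (p i))"
      by (simp add: cis_mult t_def algebra_simps)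
    also have "\<dots> = cis t" by simp
    finally have "norm (w ^ nat q - 1) = norm (exp (\<i> * of_real t) - 1)" by (simp add: cis_conv_exp)
    also have "\<dots> = 2 * \<bar>sin (t / 2)\<bar>" by (rule dist_exp_i_1)
    also have "\<dots> \<le> 2 * \<bar>t / 2\<bar>" using abs_sin_x_le_abs_x[of "t/2"] by linarith
    also have "\<dots> = 2 * pi * \<bar>of_int q * \<theta> i - of_int (p i)\<bar>" by (simp add: t_def abs_mult)
    also have "\<dots> \<le> 2 * pi * (1 / N)" using q(2)[OF i(1)] by (intro mult_left_mono) auto
    also have "\<dots> \<le> e" using N assms(3) by (simp add: field_simps)
    finally show "norm (w ^ nat q - 1) \<le> e" .
  qed
qed

text \<open>For most primes p^(-i t) is near the conjugate of a unimodular element of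
  \<open>W\<close>, so its k-th power has real part at least 1/2. The other primes have a convergent
  sum S of reciprocals. So the real part of the sum of p^(-1-\<sigma>-i k t) is at least half the
  sum of p^(-1-\<sigma>) minus 3S/2. A suitable \<sigma> makes this exceed the bound of
  \<open>sum_primes_powr_upper_bound\<close>.\<close>

lemma finitely_many_values_imp_no_twist:
  fixes w :: "nat \<Rightarrow> complex" and t :: real
  assumes W: "finite W" "\<And>p. prime p \<Longrightarrow> w p \<in> W" and w: "\<And>p. prime p \<Longrightarrow> norm (w p) \<le> 1"
    and summ: "(\<lambda>p. 1 / real p * (1 - Re (w p * of_nat p powr (- (\<i> * of_real t))))) summable_on {p. prime p}"
  shows "t = 0"
proof (rule ccontr)
  assume t: "t \<noteq> 0"
  have "\<exists>k>0. \<forall>v\<in>{v\<in>W. norm v = 1}. norm (v ^ k - 1) \<le> 1/4"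
    by (rule powers_simultaneously_near_1) (use W(1) in simp_all)
  then obtain k :: nat where k: "k > 0" "\<And>v. v \<in> W \<Longrightarrow> norm v = 1 \<Longrightarrow> norm (v ^ k - 1) \<le> 1/4"
    by blast
  \<comment> \<open>The gap between 1 and the moduli below 1 in \<open>W\<close>; the inserted 1
    keeps the minimum defined.\<close>
  define d where "d = Min (insert 1 ((\<lambda>v. 1 - norm v) ` {v\<in>W. norm v < 1}))"
  have fin: "finite (insert 1 ((\<lambda>v. 1 - norm v) ` {v\<in>W. norm v < 1}))" using W(1) by simp
  have d0: "d > 0" unfolding d_def using fin by (subst Min_gr_iff) auto
  have dW: "norm v \<le> 1 - d" if "v \<in> W" "norm v < 1" for v
  proof -
    have "d \<le> 1 - norm v" unfolding d_def by (rule Min_le[OF fin]) (use that in auto)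
    then show ?thesis by simp
  qed
  \<comment> \<open>The bound by \<open>d\<close> excludes moduli below 1. The other bound gives 2
    \<delta> \<le> (1/(4k))^2, so \<open>z p\<close> is within 1/(4k) of \<open>cnj (w p)\<close>,
    an error that grows at most k-fold in the k-th powers.\<close>
  define \<delta> where "\<delta> = min d (1 / (32 * real k ^ 2))"
  have \<delta>: "\<delta> > 0" "\<delta> \<le> d" "\<delta> \<le> 1 / (32 * real k ^ 2)" using d0 k(1) by (auto simp: \<delta>_def)
  define z where "z p = (of_nat p :: complex) powr (- (\<i> * of_real t))" for p :: nat
  have z1: "norm (z p) = 1" if "prime p" for p
    using prime_gt_0_nat[OF that] by (simp add: z_def norm_powr_real_powr)
  have good: "Re (z p ^ k) \<ge> 1/2" if p: "prime p" "Re (w p * z p) > 1 - \<delta>" for p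
  proof -
    have "Re (w p * z p) \<le> norm (w p)" using complex_Re_le_cmod[of "w p * z p"] z1[OF p(1)] by (simp add: norm_mult)
    then have "\<not> norm (w p) < 1" using dW[OF W(2)[OF p(1)]] p(2) \<delta>(2) by auto
    then have w1: "norm (w p) = 1" using w[OF p(1)] by simp
    have "norm (z p - cnj (w p)) ^ 2 = norm (z p) ^ 2 + norm (w p) ^ 2 - 2 * Re (w p * z p)"
      unfolding cmod_power2 by (simp add: power2_eq_square algebra_simps)
    also have "\<dots> \<le> 2 * \<delta>" using p(2) w1 z1[OF p(1)] by simp
    also have "\<dots> \<le> (1 / (4 * real k)) ^ 2" using \<delta>(3) by (simp add: power2_eq_square)
    finally have *: "norm (z p - cnj (w p)) \<le> 1 / (4 * real k)" by (rule power2_le_imp_le) simp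
    have "norm (z p ^ k - cnj (w p) ^ k) \<le> real k * norm (z p - cnj (w p))"
      using w1 z1[OF p(1)] by (intro norm_power_diff) auto
    also have "\<dots> \<le> real k * (1 / (4 * real k))" by (intro mult_left_mono *) simp
    finally have "norm (z p ^ k - cnj (w p) ^ k) \<le> 1/4" using k(1) by simp
    moreover have "norm (cnj (w p) ^ k - 1) \<le> 1/4"
    proof -
      have "norm (cnj (w p) ^ k - 1) = norm (cnj (w p ^ k - 1))" by simp
      also have "\<dots> = norm (w p ^ k - 1)" by (rule complex_mod_cnj)
      finally show ?thesis using k(2)[of "w p"] W(2)[OF p(1)] w1 by simp
    qed
    ultimately have "norm (z p ^ k - 1) \<le> 1/4 + 1/4"
      by (rule norm_diff_triangle_le)
    then show ?thesis using abs_Re_le_cmod[of "z p ^ k - 1"] by simp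
  qed
  define Bad where "Bad = {p. prime p \<and> Re (w p * z p) \<le> 1 - \<delta>}"
  \<comment> \<open>On \<open>Bad\<close> the term of the given series is at least
    \<delta>/p.\<close>
  have bad: "(\<lambda>p. 1 / real p) summable_on Bad"
  proof (rule summable_on_comparison_test)
    show "(\<lambda>p. 1 / \<delta> * (1 / real p * (1 - Re (w p * z p)))) summable_on Bad"
      unfolding z_def by (intro summable_on_cmult_right summable_on_subset_banach[OF summ]) (auto simp: Bad_def)
    fix p assume p: "p \<in> Bad"
    then have "1 / \<delta> * (1 / real p * \<delta>) \<le> 1 / \<delta> * (1 / real p * (1 - Re (w p * z p)))"
      using \<delta>(1) by (intro mult_left_mono) (auto simp: Bad_def)
    then show "1 / real p \<le> 1 / \<delta> * (1 / real p * (1 - Re (w p * z p)))"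
      using \<delta>(1) by simp
    show "0 \<le> 1 / real p" by simp
  qed
  define S where "S = (\<Sum>\<^sub>\<infinity>p\<in>Bad. 1 / real p)"
  obtain C where C: "\<And>\<sigma>. 0 < \<sigma> \<Longrightarrow> \<sigma> \<le> 1 \<Longrightarrow> \<exists>y. \<forall>x\<ge>y.
      Re (\<Sum>p | prime p \<and> p \<le> x. of_nat p powr (- Complex (1 + \<sigma>) (real k * t))) \<le> C"
    using sum_primes_powr_upper_bound[of "real k * t"] t k(1) by auto
  obtain \<sigma> where \<sigma>: "0 < \<sigma>" "\<sigma> \<le> 1"
    "\<And>y. \<exists>x\<ge>y. (\<Sum>p | prime p \<and> p \<le> x. real p powr (- (1 + \<sigma>))) > 2 * C + 3 * S"
    using sum_primes_powr_unbounded[of "2 * C + 3 * S"] by blast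
  define a :: "nat \<Rightarrow> complex" where "a p = of_nat p powr (- Complex (1 + \<sigma>) (real k * t))" for p
  define b where "b p = real p powr (- (1 + \<sigma>))" for p :: nat
  obtain y where "\<forall>x\<ge>y. Re (\<Sum>p | prime p \<and> p \<le> x. a p) \<le> C"
    using C[OF \<sigma>(1,2)] unfolding a_def by blast
  moreover obtain x where "x \<ge> y" and large: "(\<Sum>p | prime p \<and> p \<le> x. b p) > 2 * C + 3 * S"
    using \<sigma>(3)[of y] unfolding b_def by blast
  ultimately have upper: "Re (\<Sum>p | prime p \<and> p \<le> x. a p) \<le> C" by blast
  let ?P = "{p. prime p \<and> p \<le> x}"
  \<comment> \<open>On \<open>Bad\<close> only Re (a p) \<ge> -b p is available; writing -b as b/2 -
    3b/2 and using b \<le> 1/p produces the 3/2, and hence the threshold 2C + 3S.\<close>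
  have "1/2 * b p - 3/2 * (if p \<in> Bad then 1 / real p else 0) \<le> Re (a p)" if "p \<in> ?P" for p
  proof -
    have p: "prime p" "p > 0" using that prime_gt_0_nat by auto
    have "- Complex (1 + \<sigma>) (real k * t) = of_real (- (1 + \<sigma>)) + of_nat k * (- (\<i> * of_real t))"
      by (simp add: complex_eq_iff)
    then have "a p = of_nat p powr of_real (- (1 + \<sigma>)) * of_nat p powr (of_nat k * (- (\<i> * of_real t)))"
      unfolding a_def by (simp only: powr_add)
    also have "of_nat p powr (of_nat k * (- (\<i> * of_real t))) = z p ^ k"
      unfolding z_def by (rule powr_power[symmetric]) (use p in simp)
    also have "of_nat p powr of_real (- (1 + \<sigma>)) = complex_of_real (b p)"
      using powr_of_real[of "real p" "- (1 + \<sigma>)"] by (simp add: b_def)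
    finally have Re: "Re (a p) = b p * Re (z p ^ k)" by simp
    have b0: "b p \<ge> 0" by (simp add: b_def)
    show ?thesis
    proof (cases "p \<in> Bad")
      case True
      have "b p \<le> real p powr (-1)" unfolding b_def using p \<sigma> by (intro powr_mono) auto
      then have b: "b p \<le> 1 / real p" by (simp add: powr_minus_divide)
      have "- 1 \<le> Re (z p ^ k)"
        using abs_Re_le_cmod[of "z p ^ k"] z1[OF p(1)] by (simp add: norm_power abs_le_iff)
      then have "b p * (- 1) \<le> Re (a p)" unfolding Re using b0 by (intro mult_left_mono)
      then show ?thesis using True b by simp
    next
      case False
      then have "1/2 \<le> Re (z p ^ k)" using good p(1) by (auto simp: Bad_def)
      then have "b p * (1/2) \<le> Re (a p)" unfolding Re using b0 by (intro mult_left_mono)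
      then show ?thesis using False by simp
    qed
  qed
  then have "(\<Sum>p\<in>?P. 1/2 * b p - 3/2 * (if p \<in> Bad then 1 / real p else 0)) \<le> (\<Sum>p\<in>?P. Re (a p))"
    by (rule sum_mono)
  also have "(\<Sum>p\<in>?P. 1/2 * b p - 3/2 * (if p \<in> Bad then 1 / real p else 0))
      = 1/2 * (\<Sum>p\<in>?P. b p) - 3/2 * (\<Sum>p\<in>?P \<inter> Bad. 1 / real p)"
    by (simp only: sum.inter_restrict[OF finite_primes_le] sum_subtractf sum_distrib_left)
  finally have "1/2 * (\<Sum>p\<in>?P. b p) \<le> C + 3/2 * (\<Sum>p\<in>?P \<inter> Bad. 1 / real p)"
    using upper by simp
  also have "(\<Sum>p\<in>?P \<inter> Bad. 1 / real p) \<le> S"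
    unfolding S_def using finite_primes_le by (intro finite_sum_le_infsum[OF bad]) auto
  finally show False using large by linarith
qed

text \<open>Once t = 0, the gap \<open>d\<close> in real part lets 1/p be dominated by 1/d times the
  term of the series wherever \<open>w p \<noteq> 1\<close>. Where \<open>w p = 1\<close>, both
  factors have modulus 1, as neither exceeds it, and so \<open>f p = \<psi> p\<close>.\<close>

lemma summable_primes_ne_character:
  fixes f :: "nat \<Rightarrow> complex"
  assumes f: "f \<in> mult_unit_disc" and pret: "pretentious f" and fin: "finite (f ` {0<..})"
  obtains q \<psi> where "dirichlet_character q \<psi>" "f 1 = 1"
    "(\<lambda>p. 1 / real p) summable_on {p. prime p \<and> f p \<noteq> \<psi> p}"
proof -
  obtain q \<psi> t where \<psi>: "dirichlet_character q \<psi>" and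
    summ: "(\<lambda>p. 1 / real p * (1 - Re (f p * cnj (\<psi> p * of_nat p powr (\<i> * of_real t))))) summable_on {p. prime p}"
    using pret unfolding pretentious_def by blast
  define w where "w p = f p * cnj (\<psi> p)" for p
  define W where "W = (\<lambda>(a, b). a * cnj b) ` (f ` {0<..} \<times> range \<psi>)"
  have W: "finite W" unfolding W_def
    using fin dirichlet_character_finite_range[OF \<psi>] by simp
  have wW: "w p \<in> W" if "prime p" for p
    using prime_gt_0_nat[OF that] unfolding w_def W_def by force
  have f_le: "norm (f p) \<le> 1" if "prime p" for p
    using f prime_gt_0_nat[OF that] unfolding mult_unit_disc_def by blast
  have w_le: "norm (w p) \<le> 1" if "prime p" for p
    using f_le[OF that] dirichlet_character_norm_le_1[OF \<psi>, of p]
    by (simp add: w_def norm_mult mult_le_one)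
  have "cnj (of_nat p powr (\<i> * of_real t)) = of_nat p powr (- (\<i> * of_real t))" for p :: nat
    by (cases "p = 0") (simp_all add: cnj_powr complex_eq_iff)
  then have summ': "(\<lambda>p. 1 / real p * (1 - Re (w p * of_nat p powr (- (\<i> * of_real t))))) summable_on {p. prime p}"
    using summ by (simp add: w_def mult.assoc)
  have "t = 0" by (rule finitely_many_values_imp_no_twist[OF W wW w_le summ'])
  then have "(\<lambda>p. 1 / real p * (1 - Re (w p * of_nat p powr (- (\<i> * of_real t))))) summable_on {p. prime p}
      \<longleftrightarrow> (\<lambda>p. 1 / real p * (1 - Re (w p))) summable_on {p. prime p}"
    by (intro summable_on_cong) simp
  then have summ0: "(\<lambda>p. 1 / real p * (1 - Re (w p))) summable_on {p. prime p}"
    using summ' by blast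
  define d where "d = Min (insert 1 ((\<lambda>v. 1 - Re v) ` {v\<in>W. Re v < 1}))"
  have finS: "finite (insert 1 ((\<lambda>v. 1 - Re v) ` {v\<in>W. Re v < 1}))" using W by simp
  have d0: "d > 0" unfolding d_def using finS by (subst Min_gr_iff) auto
  have bad: "(\<lambda>p. 1 / real p) summable_on {p. prime p \<and> w p \<noteq> 1}"
  proof (rule summable_on_comparison_test)
    show "(\<lambda>p. 1 / d * (1 / real p * (1 - Re (w p)))) summable_on {p. prime p \<and> w p \<noteq> 1}"
      by (intro summable_on_cmult_right summable_on_subset_banach[OF summ0]) auto
    fix p assume p: "p \<in> {p. prime p \<and> w p \<noteq> 1}"
    have "Re (w p) \<noteq> 1"
    proof
      assume R: "Re (w p) = 1"
      have "Re (w p) ^ 2 + Im (w p) ^ 2 \<le> 1"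
        using w_le[of p] p unfolding cmod_power2[symmetric] by (simp add: power_le_one)
      with R p show False by (simp add: complex_eq_iff)
    qed
    moreover have "Re (w p) \<le> 1" using complex_Re_le_cmod[of "w p"] w_le[of p] p by simp
    ultimately have "Re (w p) < 1" by simp
    then have "d \<le> 1 - Re (w p)" unfolding d_def using wW p by (intro Min_le[OF finS]) auto
    then have "1 / d * (1 / real p * d) \<le> 1 / d * (1 / real p * (1 - Re (w p)))"
      using d0 by (intro mult_left_mono) auto
    then show "1 / real p \<le> 1 / d * (1 / real p * (1 - Re (w p)))"
      using d0 by simp
  qed simp
  \<comment> \<open>The zero function is multiplicative in the given sense, so
    \<open>f 1 = 1\<close> needs a nonzero value. A prime with \<open>w p = 1\<close> provides it,
    and one exists because the sum of 1/p over all primes diverges.\<close>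
  have "\<not> (\<forall>p. prime p \<longrightarrow> w p \<noteq> 1)"
  proof
    assume "\<forall>p. prime p \<longrightarrow> w p \<noteq> 1"
    then have "{p. prime p \<and> w p \<noteq> 1} = {p. prime p}" by auto
    with bad have s: "(\<lambda>p. 1 / real p) summable_on {p. prime p}" by simp
    obtain \<sigma> where "0 < \<sigma>" and *: "\<And>y. \<exists>x\<ge>y.
      (\<Sum>p | prime p \<and> p \<le> x. real p powr (- (1 + \<sigma>))) > (\<Sum>\<^sub>\<infinity>p\<in>{p. prime p}. 1 / real p)"
      using sum_primes_powr_unbounded[of "\<Sum>\<^sub>\<infinity>p\<in>{p. prime p}. 1 / real p"] by blast
    then obtain x where \<sigma>: "0 < \<sigma>"
      "(\<Sum>p | prime p \<and> p \<le> x. real p powr (- (1 + \<sigma>))) > (\<Sum>\<^sub>\<infinity>p\<in>{p. prime p}. 1 / real p)"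
      using *[of 0] by blast
    have "(\<Sum>p | prime p \<and> p \<le> x. real p powr (- (1 + \<sigma>))) \<le> (\<Sum>p | prime p \<and> p \<le> x. 1 / real p)"
    proof (rule sum_mono)
      fix p assume "p \<in> {p. prime p \<and> p \<le> x}"
      then have "real p \<ge> 1" using prime_ge_1_nat[of p] by simp
      then have "real p powr (- (1 + \<sigma>)) \<le> real p powr (-1)" using \<sigma>(1) by (intro powr_mono) auto
      then show "real p powr (- (1 + \<sigma>)) \<le> 1 / real p" by (simp add: powr_minus_divide)
    qed
    also have "\<dots> \<le> (\<Sum>\<^sub>\<infinity>p\<in>{p. prime p}. 1 / real p)"
      by (intro finite_sum_le_infsum[OF s finite_primes_le]) auto
    finally show False using \<sigma>(2) by simp
  qed
  then obtain p where p: "prime p" "w p = 1" by blast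
  have "\<forall>m>0. \<forall>n>0. coprime m n \<longrightarrow> f (m * n) = f m * f n"
    using f by (simp add: mult_unit_disc_def)
  from this[rule_format, of p 1] have "f (p * 1) = f p * f 1"
    using prime_gt_0_nat[OF p(1)] by simp
  moreover have "f p \<noteq> 0" using p(2) by (auto simp: w_def)
  ultimately have f1: "f 1 = 1" by simp
  have "f p = \<psi> p" if p: "prime p" "w p = 1" for p
  proof -
    have "norm (f p) * norm (\<psi> p) = 1" using p(2) by (metis w_def norm_mult complex_mod_cnj norm_one)
    moreover have "norm (f p) * norm (\<psi> p) \<le> 1 * norm (\<psi> p)"
      by (rule mult_right_mono[OF f_le[OF p(1)]]) simp
    ultimately have "norm (\<psi> p) = 1"
      using dirichlet_character_norm_le_1[OF \<psi>, of p] by simp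
    then have "cnj (\<psi> p) * \<psi> p = 1"
      using complex_norm_square[of "\<psi> p"] by (simp add: mult.commute)
    then have "f p = w p * \<psi> p" by (simp add: w_def mult.assoc)
    with p(2) show ?thesis by simp
  qed
  then have "(\<lambda>p. 1 / real p) summable_on {p. prime p \<and> f p \<noteq> \<psi> p}"
    by (intro summable_on_subset_banach[OF bad]) auto
  with \<psi> f1 show thesis by (rule that)
qed

section \<open>Mean almost periodicity along the orbit\<close>

lemma sum_shift_diff_le:
  fixes a :: "nat \<Rightarrow> real"
  assumes B: "\<And>n. \<bar>a n\<bar> \<le> B"
  shows "\<bar>(\<Sum>n=1..N. a (n + i)) - (\<Sum>n=1..N. a n)\<bar> \<le> 2 * B * real i"
proof (induction i)
  case (Suc i)
  have "(\<Sum>n=1..N. a (n + Suc i)) - (\<Sum>n=1..N. a (n + i)) = a (N + Suc i) - a (1 + i)"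
    using sum_telescope''[of 0 N "\<lambda>n. a (n + i + 1)"]
    by (simp add: sum_subtractf atLeastSucAtMost_greaterThanAtMost sum.distrib)
  moreover have "\<bar>a (N + Suc i) - a (1 + i)\<bar> \<le> 2 * B"
    using B[of "N + Suc i"] B[of "1 + i"] by linarith
  ultimately show ?case using Suc by (simp add: algebra_simps)
qed simp

text \<open>Besicovitch rational almost periodicity for real sequences. As e is arbitrary, the
  eventual bound replaces a limsup and avoids dividing by N.\<close>

definition mean_almost_periodic :: "(nat \<Rightarrow> real) \<Rightarrow> bool" where
  "mean_almost_periodic a \<longleftrightarrow> (\<forall>e>0. \<exists>r>0. \<exists>G. (\<forall>n. G (n + r) = G n) \<and>
     (\<forall>\<^sub>F N in sequentially. (\<Sum>n=1..N. \<bar>a n - G n\<bar>) \<le> e * real N))"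

lemma periodic_block_sum:
  fixes G :: "nat \<Rightarrow> real"
  assumes "\<And>n. G (n + r) = G n"
  shows "(\<Sum>i<r. G (n + i)) = (\<Sum>i<r. G i)"
proof (induction n)
  case (Suc n)
  have "(\<Sum>i<r. G (Suc n + i)) + G n = (\<Sum>i<Suc r. G (n + i))"
    unfolding sum.lessThan_Suc_shift by simp
  then show ?case using Suc assms[of n] by simp
qed simp

text \<open>All blocks of length r in a sequence of period r have the same average, and
  \<open>m\<close> is that average for the periodic approximant \<open>G\<close>. Replacing
  \<open>a\<close> by its block averages changes the mean only by boundary terms.\<close>

lemma mean_almost_periodic_block_average:
  assumes B: "\<And>n. \<bar>a n\<bar> \<le> B" and ap: "mean_almost_periodic a" and e: "e > 0"
  obtains r m where "r > 0"
    "\<forall>\<^sub>F N in sequentially. (\<Sum>n=1..N. \<bar>(\<Sum>i<r. a (n + i)) / real r - m\<bar>) \<le> e * real N"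
    "\<forall>\<^sub>F N in sequentially. \<bar>(\<Sum>n=1..N. a n) / real N - m\<bar> \<le> e"
proof -
  \<comment> \<open>One factor 2 is lost because the blocks reach up to N + r \<le> 2N; another
    leaves room for the boundary terms 2 B r.\<close>
  have e4: "e / 4 > 0" using e by simp
  obtain r G where r: "r > 0" and G: "\<And>n. G (n + r) = G n"
    and ev: "\<forall>\<^sub>F N in sequentially. (\<Sum>n=1..N. \<bar>a n - G n\<bar>) \<le> e / 4 * real N"
    using ap e4 unfolding mean_almost_periodic_def by meson
  define m where "m = (\<Sum>i<r. G i) / real r"
  have blocks: "\<forall>\<^sub>F N in sequentially. (\<Sum>n=1..N. \<bar>(\<Sum>i<r. a (n + i)) / real r - m\<bar>) \<le> e / 2 * real N"
  proof -
    have "\<forall>\<^sub>F N in sequentially. (\<Sum>n=1..N+r. \<bar>a n - G n\<bar>) \<le> e / 4 * real (N + r)"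
      using ev by (subst (asm) eventually_sequentially_seg[of _ r, symmetric]) simp
    then show ?thesis using eventually_ge_at_top[of r]
    proof eventually_elim
      case (elim N)
      have "(\<Sum>n=1..N. \<bar>(\<Sum>i<r. a (n + i)) / real r - m\<bar>)
          \<le> (\<Sum>n=1..N. \<Sum>i<r. \<bar>a (n + i) - G (n + i)\<bar> / real r)"
      proof (rule sum_mono)
        fix n
        have "(\<Sum>i<r. a (n + i)) / real r - m = (\<Sum>i<r. (a (n + i) - G (n + i)) / real r)"
          using periodic_block_sum[of G r n] G
          by (simp add: m_def sum_subtractf sum_divide_distrib[symmetric] diff_divide_distrib)
        also have "\<bar>\<dots>\<bar> \<le> (\<Sum>i<r. \<bar>(a (n + i) - G (n + i)) / real r\<bar>)" by (rule sum_abs)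
        finally show "\<bar>(\<Sum>i<r. a (n + i)) / real r - m\<bar> \<le> (\<Sum>i<r. \<bar>a (n + i) - G (n + i)\<bar> / real r)"
          by simp
      qed
      also have "\<dots> = (\<Sum>i<r. (\<Sum>n=1..N. \<bar>a (n + i) - G (n + i)\<bar>) / real r)"
        unfolding sum_divide_distrib by (rule sum.swap)
      also have "\<dots> \<le> (\<Sum>i<r. (e / 4 * real (N + r)) / real r)"
      proof (intro sum_mono divide_right_mono)
        fix i assume i: "i \<in> {..<r}"
        have "(\<Sum>n=1..N. \<bar>a (n + i) - G (n + i)\<bar>) = (\<Sum>n=1+i..N+i. \<bar>a n - G n\<bar>)"
          by (rule sum.shift_bounds_cl_nat_ivl[symmetric])
        also have "\<dots> \<le> (\<Sum>n=1..N+r. \<bar>a n - G n\<bar>)" using i by (intro sum_mono2) auto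
        finally show "(\<Sum>n=1..N. \<bar>a (n + i) - G (n + i)\<bar>) \<le> e / 4 * real (N + r)" using elim(1) by simp
      qed simp
      also have "\<dots> = e / 4 * real (N + r)" using r by simp
      also have "\<dots> \<le> e / 4 * (2 * real N)" using elim(2) e by (intro mult_left_mono) auto
      finally show ?case by simp
    qed
  qed
  show thesis
  proof (rule that[OF r])
    show "\<forall>\<^sub>F N in sequentially. (\<Sum>n=1..N. \<bar>(\<Sum>i<r. a (n + i)) / real r - m\<bar>) \<le> e * real N"
      using blocks
    proof eventually_elim
      case (elim N)
      have "e / 2 * real N \<le> e * real N" using e by (intro mult_right_mono) auto
      with elim show ?case by linarith
    qed
    have "\<forall>\<^sub>F N in sequentially. 2 * B * real r \<le> e / 2 * real N"
      using e by real_asymp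
    then show "\<forall>\<^sub>F N in sequentially. \<bar>(\<Sum>n=1..N. a n) / real N - m\<bar> \<le> e"
      using blocks eventually_gt_at_top[of 0]
    proof eventually_elim
      case (elim N)
      have B0: "B \<ge> 0" using B[of 0] by linarith
      have "\<bar>(\<Sum>n=1..N. a n) - (\<Sum>n=1..N. (\<Sum>i<r. a (n + i)) / real r)\<bar> \<le> 2 * B * real r"
      proof -
        have "(\<Sum>n=1..N. a n) - (\<Sum>n=1..N. (\<Sum>i<r. a (n + i)) / real r)
          = (\<Sum>i<r. ((\<Sum>n=1..N. a n) - (\<Sum>n=1..N. a (n + i))) / real r)"
          using r sum.swap[of "\<lambda>n i. a (n + i)" "{..<r}" "{1..N}"]
          by (simp add: sum_divide_distrib[symmetric] sum_subtractf diff_divide_distrib)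
        also have "\<bar>\<dots>\<bar> \<le> (\<Sum>i<r. \<bar>((\<Sum>n=1..N. a n) - (\<Sum>n=1..N. a (n + i))) / real r\<bar>)" by (rule sum_abs)
        also have "\<dots> \<le> (\<Sum>i<r. (2 * B * real r) / real r)"
        proof (rule sum_mono)
          fix i assume i: "i \<in> {..<r}"
          have "\<bar>(\<Sum>n=1..N. a n) - (\<Sum>n=1..N. a (n + i))\<bar> \<le> 2 * B * real i"
            using sum_shift_diff_le[where a = a and B = B and N = N and i = i] B
            by (simp add: abs_minus_commute)
          also have "\<dots> \<le> 2 * B * real r" using i B0 by (intro mult_left_mono) auto
          finally show "\<bar>((\<Sum>n=1..N. a n) - (\<Sum>n=1..N. a (n + i))) / real r\<bar> \<le> (2 * B * real r) / real r"
            unfolding abs_divide by (simp only: abs_of_nat divide_right_mono of_nat_0_le_iff)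
        qed
        also have "\<dots> = 2 * B * real r" using r by simp
        finally show ?thesis .
      qed
      moreover have "\<bar>(\<Sum>n=1..N. (\<Sum>i<r. a (n + i)) / real r) - real N * m\<bar> \<le> e / 2 * real N"
      proof -
        have "(\<Sum>n=1..N. (\<Sum>i<r. a (n + i)) / real r) - real N * m
          = (\<Sum>n=1..N. (\<Sum>i<r. a (n + i)) / real r - m)" by (simp add: sum_subtractf)
        also have "\<bar>\<dots>\<bar> \<le> (\<Sum>n=1..N. \<bar>(\<Sum>i<r. a (n + i)) / real r - m\<bar>)" by (rule sum_abs)
        finally show ?thesis using elim(2) by linarith
      qed
      ultimately have "\<bar>(\<Sum>n=1..N. a n) - real N * m\<bar> \<le> e * real N" using elim(1) by linarith
      moreover have "(\<Sum>n=1..N. a n) / real N - m = ((\<Sum>n=1..N. a n) - real N * m) / real N"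
        using elim(3) by (simp add: diff_divide_distrib)
      ultimately show ?case using elim(3) by (simp add: abs_divide pos_divide_le_eq)
    qed
  qed
qed

text \<open>The constant \<open>m\<close> of the block averages depends on e. Being within e of all
  late means, it shows that these form a Cauchy sequence, and it can then be replaced by their
  limit.\<close>

lemma mean_almost_periodic_mean:
  assumes B: "\<And>n. \<bar>a n\<bar> \<le> B" and ap: "mean_almost_periodic a"
  obtains c where "(\<lambda>N. (\<Sum>n=1..N. a n) / real N) \<longlonglongrightarrow> c"
    "\<And>e. e > 0 \<Longrightarrow> \<exists>r>0. \<forall>\<^sub>F N in sequentially.
       (\<Sum>n=1..N. \<bar>(\<Sum>i<r. a (n + i)) / real r - c\<bar>) \<le> e * real N"
proof -
  define A where "A N = (\<Sum>n=1..N. a n) / real N" for N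
  have "Cauchy A"
  proof (rule metric_CauchyI)
    fix e :: real assume "e > 0"
    then have e3: "e / 3 > 0" by simp
    obtain r m where "\<forall>\<^sub>F N in sequentially. \<bar>(\<Sum>n=1..N. a n) / real N - m\<bar> \<le> e / 3"
      by (rule mean_almost_periodic_block_average[OF B ap e3])
    then have "\<forall>\<^sub>F N in sequentially. \<bar>A N - m\<bar> \<le> e / 3" by (simp add: A_def)
    then obtain M where M: "\<And>N. N \<ge> M \<Longrightarrow> \<bar>A N - m\<bar> \<le> e / 3" by (auto simp: eventually_sequentially)
    have "dist (A k) (A l) < e" if "k \<ge> M" "l \<ge> M" for k l
      using M[OF that(1)] M[OF that(2)] \<open>e > 0\<close> unfolding dist_real_def by linarith
    then show "\<exists>M. \<forall>k\<ge>M. \<forall>l\<ge>M. dist (A k) (A l) < e" by blast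
  qed
  then obtain c where c: "A \<longlonglongrightarrow> c" using Cauchy_convergent_iff convergent_def by metis
  show thesis
  proof
    show "(\<lambda>N. (\<Sum>n=1..N. a n) / real N) \<longlonglongrightarrow> c" using c unfolding A_def .
    fix e :: real assume "e > 0"
    then have e2: "e / 2 > 0" by simp
    obtain r m where r: "r > 0"
      and bl: "\<forall>\<^sub>F N in sequentially. (\<Sum>n=1..N. \<bar>(\<Sum>i<r. a (n + i)) / real r - m\<bar>) \<le> e / 2 * real N"
      and "\<forall>\<^sub>F N in sequentially. \<bar>(\<Sum>n=1..N. a n) / real N - m\<bar> \<le> e / 2"
      by (rule mean_almost_periodic_block_average[OF B ap e2])
    then have m: "\<forall>\<^sub>F N in sequentially. \<bar>A N - m\<bar> \<le> e / 2" by (simp add: A_def)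
    have "(\<lambda>N. \<bar>A N - m\<bar>) \<longlonglongrightarrow> \<bar>c - m\<bar>" by (intro tendsto_intros c)
    then have cm: "\<bar>c - m\<bar> \<le> e / 2" using m by (rule tendsto_upperbound) simp
    have "\<forall>\<^sub>F N in sequentially. (\<Sum>n=1..N. \<bar>(\<Sum>i<r. a (n + i)) / real r - c\<bar>) \<le> e * real N"
      using bl
    proof eventually_elim
      case (elim N)
      have "(\<Sum>n=1..N. \<bar>(\<Sum>i<r. a (n + i)) / real r - c\<bar>)
          \<le> (\<Sum>n=1..N. \<bar>(\<Sum>i<r. a (n + i)) / real r - m\<bar> + e / 2)"
      proof (rule sum_mono)
        show "\<bar>(\<Sum>i<r. a (n + i)) / real r - c\<bar> \<le> \<bar>(\<Sum>i<r. a (n + i)) / real r - m\<bar> + e / 2" for n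
          using cm by linarith
      qed
      also have "\<dots> = (\<Sum>n=1..N. \<bar>(\<Sum>i<r. a (n + i)) / real r - m\<bar>) + e / 2 * real N"
        by (simp add: sum.distrib)
      also have "\<dots> \<le> e * real N" using elim by (simp add: field_simps)
      finally show ?case .
    qed
    with r show "\<exists>r>0. \<forall>\<^sub>F N in sequentially.
       (\<Sum>n=1..N. \<bar>(\<Sum>i<r. a (n + i)) / real r - c\<bar>) \<le> e * real N" by blast
  qed
qed

section \<open>The orbit closure as a compact space of sequences\<close>

definition orbit_point :: "(nat \<Rightarrow> complex) \<Rightarrow> nat \<Rightarrow> int \<Rightarrow> complex" where
  "orbit_point f n = shift_by (int n) (extend_zero f)"

lemma orbit_point_in_closure: "orbit_point f n \<in> orbit_closure f"
  unfolding orbit_closure_def orbit_point_def by (rule subsetD[OF closure_subset]) auto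

lemma left_shift_orbit_point: "left_shift (orbit_point f n) = orbit_point f (Suc n)"
  by (simp add: orbit_point_def shift_by_def algebra_simps)

lemma continuous_on_left_shift: "continuous_on S (left_shift :: (int \<Rightarrow> 'a::topological_space) \<Rightarrow> _)"
  unfolding shift_by_def
  by (intro continuous_on_coordinatewise_then_product continuous_on_product_coordinates
        continuous_on_subset[OF continuous_on_product_coordinates]) auto

lemma closed_orbit_closure: "closed (orbit_closure f)"
  by (simp add: orbit_closure_def)

lemma left_shift_in_orbit_closure:
  assumes "x \<in> orbit_closure f"
  shows "left_shift x \<in> orbit_closure f"
proof -
  let ?O = "{shift_by k (extend_zero f) | k. True}"
  have "left_shift ` closure ?O \<subseteq> closure ?O"
  proof (rule image_closure_subset)
    have "left_shift (shift_by k (extend_zero f)) = shift_by (k + 1) (extend_zero f)" for k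
      by (simp add: shift_by_def algebra_simps)
    then have "left_shift ` ?O \<subseteq> ?O" by auto
    then show "left_shift ` ?O \<subseteq> closure ?O" using closure_subset by blast
  qed (auto intro: continuous_on_left_shift)
  then show ?thesis using assms unfolding orbit_closure_def by blast
qed

text \<open>Coordinates are continuous and a finite set is closed, so the restriction on values
  passes from the orbit to its closure. The value 0 comes from the non-positive integers.\<close>

lemma orbit_closure_values:
  assumes "finite (f ` {0<..})" "x \<in> orbit_closure f"
  shows "x j \<in> insert 0 (f ` {0<..})"
proof -
  let ?F = "insert 0 (f ` {0<..})"
  have cl: "closed ?F" using assms(1) by (intro finite_imp_closed) simp
  have "closed ((\<lambda>x. x j) -` ?F)"
    by (rule continuous_closed_vimage[OF cl]) (simp add: continuous_on_product_coordinates continuous_on_interior[of UNIV])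
  moreover have "{shift_by k (extend_zero f) | k. True} \<subseteq> (\<lambda>x. x j) -` ?F"
    by (auto simp: shift_by_def extend_zero_def)
  ultimately have "orbit_closure f \<subseteq> (\<lambda>x. x j) -` ?F"
    unfolding orbit_closure_def by (rule closure_minimal[rotated])
  then show ?thesis using assms(2) by auto
qed

lemma compact_orbit_closure:
  assumes "finite (f ` {0<..})"
  shows "compact (orbit_closure f)"
proof -
  let ?F = "insert 0 (f ` {0<..})"
  have "compactin (product_topology (\<lambda>i::int. euclidean) UNIV) (PiE UNIV (\<lambda>_. ?F))"
    using assms by (simp add: compactin_PiE finite_imp_compact)
  then have "compact (PiE UNIV (\<lambda>_::int. ?F))" by (simp add: euclidean_product_topology)
  moreover have "orbit_closure f \<subseteq> PiE UNIV (\<lambda>_. ?F)"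
    using orbit_closure_values[OF assms] by auto
  ultimately show ?thesis
    using closed_orbit_closure compact_Int_closed by (metis inf.absorb_iff2)
qed

text \<open>The metric on functions enumerates the indices by \<open>from_nat\<close> with geometric
  weights. Indices enumerated after M contribute at most (1/2)^M, and \<open>J\<close> covers the
  earlier ones.\<close>

lemma dist_small_if_eq_near_zero:
  assumes "\<delta> > 0"
  obtains J :: nat where "\<And>x y :: int \<Rightarrow> 'a::metric_space.
    (\<And>j. \<bar>j\<bar> \<le> int J \<Longrightarrow> x j = y j) \<Longrightarrow> dist x y < \<delta>"
proof -
  obtain M where M: "(1/2) ^ M < \<delta>" using real_arch_pow_inv[of \<delta> "1/2"] assms by auto
  define J where "J = nat (Max ((\<lambda>n. \<bar>from_nat n :: int\<bar>) ` {..M}))"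
  have J: "\<bar>from_nat n :: int\<bar> \<le> int J" if "n \<le> M" for n
  proof -
    have "\<bar>from_nat n :: int\<bar> \<le> Max ((\<lambda>n. \<bar>from_nat n :: int\<bar>) ` {..M})"
      using that by (intro Max_ge) auto
    then show ?thesis unfolding J_def by linarith
  qed
  show thesis
  proof
    fix x y :: "int \<Rightarrow> 'a" assume eq: "\<And>j. \<bar>j\<bar> \<le> int J \<Longrightarrow> x j = y j"
    have "{dist (x (from_nat n)) (y (from_nat n)) |n. n \<le> M} = (\<lambda>n. dist (x (from_nat n)) (y (from_nat n))) ` {..M}"
      by auto
    also have "\<dots> = (\<lambda>_. 0) ` {..M}" using eq J by (intro image_cong) auto
    finally have "{dist (x (from_nat n)) (y (from_nat n)) |n. n \<le> M} = {0}" by auto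
    then have "dist x y \<le> (1/2) ^ M" using dist_fun_le_dist_first_terms[of x y M] by simp
    then show "dist x y < \<delta>" using M by linarith
  qed
qed

text \<open>The two properties through which \<open>f\<close> enters the dynamics: the first makes
  the orbit closure compact, the second makes windows of \<open>f\<close> periodic up to small
  density.\<close>

locale finite_valued_near_periodic =
  fixes f :: "nat \<Rightarrow> complex"
  assumes finite_values: "finite (f ` {0<..})"
    and near_periodic: "\<And>e. e > 0 \<Longrightarrow> \<exists>g r. r > 0 \<and> (\<forall>n. g (n + r) = g n) \<and>
      (\<forall>N. real (card {n\<in>{1..N}. f n \<noteq> g n}) \<le> e * real N)"
begin

abbreviation X :: "(int \<Rightarrow> complex) set" where "X \<equiv> orbit_closure f"

lemma continuous_bounded:
  assumes "continuous_on X (h :: _ \<Rightarrow> real)"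
  obtains B where "B \<ge> 0" "\<And>x. x \<in> X \<Longrightarrow> \<bar>h x\<bar> \<le> B"
proof -
  have "bounded (h ` X)"
    using compact_continuous_image[OF assms compact_orbit_closure[OF finite_values]]
    by (rule compact_imp_bounded)
  then obtain B where "\<And>x. x \<in> X \<Longrightarrow> \<bar>h x\<bar> \<le> B" unfolding bounded_iff by auto
  then show thesis using that[of "max 0 B"] by fastforce
qed

text \<open>By uniform continuity, \<open>h (orbit_point f n)\<close> is determined up to e/2 by the
  window of \<open>f\<close> of radius J around n. At good n this is a window of \<open>g\<close>
  and depends only on n mod r. Since \<open>h\<close> is controlled only on \<open>X\<close>, the
  approximant \<open>G\<close> takes values of \<open>h\<close> at actual orbit points, not at
  points built from \<open>g\<close>.\<close>

lemma mean_almost_periodic_observable: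
  assumes h: "continuous_on X (h :: _ \<Rightarrow> real)"
  shows "mean_almost_periodic (\<lambda>n. h (orbit_point f n))"
  unfolding mean_almost_periodic_def
proof (intro allI impI)
  fix e :: real assume e: "e > 0"
  obtain B where B: "B \<ge> 0" "\<And>x. x \<in> X \<Longrightarrow> \<bar>h x\<bar> \<le> B" by (rule continuous_bounded[OF h]) blast
  have "uniformly_continuous_on X h"
    by (rule compact_uniformly_continuous[OF h compact_orbit_closure[OF finite_values]])
  then obtain \<delta> where \<delta>: "\<delta> > 0"
    "\<And>x y. x \<in> X \<Longrightarrow> y \<in> X \<Longrightarrow> dist y x < \<delta> \<Longrightarrow> dist (h y) (h x) < e / 2"
    using e unfolding uniformly_continuous_on_def by (meson half_gt_zero)
  obtain J :: nat where J: "\<And>x y :: int \<Rightarrow> complex.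
      (\<And>j. \<bar>j\<bar> \<le> int J \<Longrightarrow> x j = y j) \<Longrightarrow> dist x y < \<delta>"
    using dist_small_if_eq_near_zero[OF \<delta>(1)] by blast
  \<comment> \<open>The bad n cost at most 2 B (2J + 1) e' (N + J) apart from a constant, which is
    now at most (e/4) (N + J); B + 1 guards against B = 0.\<close>
  define e' where "e' = e / (8 * (B + 1) * (2 * real J + 1))"
  have e': "e' > 0" using e B(1) by (simp add: e'_def)
  obtain g r where r: "r > 0" and g: "\<And>n. g (n + r) = g n"
    and card: "\<And>N. real (card {n\<in>{1..N}. f n \<noteq> g n}) \<le> e' * real N"
    using near_periodic[OF e'] by blast
  have g_mod: "g n = g (n mod r)" for n
  proof -
    have "g (m + r * k) = g m" for m k
      by (induction k) (simp_all add: g add.commute[of r] flip: add.assoc)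
    from this[of "n mod r" "n div r"] show ?thesis by simp
  qed
  \<comment> \<open>\<open>J < n\<close> keeps the window within the positive integers, where
    \<open>extend_zero f\<close> agrees with \<open>f\<close>.\<close>
  define good where "good n \<longleftrightarrow> J < n \<and> (\<forall>j\<in>{-int J..int J}. f (nat (int n + j)) = g (nat (int n + j)))" for n
  define a where "a n = h (orbit_point f n)" for n
  have aB: "\<bar>a n\<bar> \<le> B" for n unfolding a_def by (rule B(2)[OF orbit_point_in_closure])
  have close: "\<bar>a n - a m\<bar> \<le> e / 2" if "good n" "good m" "n mod r = m mod r" for n m
  proof -
    have "orbit_point f n j = orbit_point f m j" if j: "\<bar>j\<bar> \<le> int J" for j
    proof -
      have jm: "j \<in> {-int J..int J}" using j by auto
      have pos: "int n + j > 0" "int m + j > 0" using \<open>good n\<close> \<open>good m\<close> j by (auto simp: good_def)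
      have "(int n + j) mod int r = (int m + j) mod int r"
        using \<open>n mod r = m mod r\<close> by (metis mod_add_left_eq zmod_int)
      then have "nat (int n + j) mod r = nat (int m + j) mod r"
        using pos by (metis nat_int nat_mod_distrib of_nat_0_le_iff order_less_imp_le)
      then have "g (nat (int n + j)) = g (nat (int m + j))" by (metis g_mod)
      then show ?thesis
        using \<open>good n\<close> \<open>good m\<close> jm pos
        by (simp add: orbit_point_def shift_by_def extend_zero_def good_def add.commute)
    qed
    then have "dist (orbit_point f n) (orbit_point f m) < \<delta>" by (rule J)
    from \<delta>(2)[OF orbit_point_in_closure orbit_point_in_closure this]
    show ?thesis by (simp add: a_def dist_real_def)
  qed
  \<comment> \<open>A good representative is chosen in each residue class; classes without one
    receive 0 and contain only bad n.\<close>
  define G where "G n = (if \<exists>m. good m \<and> m mod r = n mod r then a (SOME m. good m \<and> m mod r = n mod r) else 0)" for n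
  have G_le: "\<bar>G n\<bar> \<le> B" for n using aB B(1) by (simp add: G_def)
  have G_close: "\<bar>a n - G n\<bar> \<le> e / 2" if "good n" for n
  proof -
    have ex: "\<exists>m. good m \<and> m mod r = n mod r" using that by blast
    from someI_ex[OF this] have "good (SOME m. good m \<and> m mod r = n mod r)"
      "n mod r = (SOME m. good m \<and> m mod r = n mod r) mod r" by auto
    from close[OF that this] ex show ?thesis by (simp add: G_def)
  qed
  have bad: "real (card {n\<in>{1..N}. \<not> good n}) \<le> real J + (2 * real J + 1) * (e' * real (N + J))" for N
  proof -
    let ?E = "{n\<in>{1..N+J}. f n \<noteq> g n}"
    let ?S = "\<lambda>j. {n\<in>{1..N}. J < n \<and> f (nat (int n + j)) \<noteq> g (nat (int n + j))}"
    have "{n\<in>{1..N}. \<not> good n} \<subseteq> {1..J} \<union> (\<Union>j\<in>{-int J..int J}. ?S j)"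
      by (auto simp: good_def)
    then have "card {n\<in>{1..N}. \<not> good n} \<le> card ({1..J} \<union> (\<Union>j\<in>{-int J..int J}. ?S j))"
      by (intro card_mono) auto
    also have "\<dots> \<le> card {1..J} + card (\<Union>j\<in>{-int J..int J}. ?S j)" by (rule card_Un_le)
    also have "card (\<Union>j\<in>{-int J..int J}. ?S j) \<le> (\<Sum>j\<in>{-int J..int J}. card (?S j))"
      by (rule card_UN_le) simp
    \<comment> \<open>Translation by j maps the failures at offset j injectively into the failures
      of f = g up to N + J.\<close>
    also have "\<dots> \<le> (\<Sum>j\<in>{-int J..int J}. card ?E)"
    proof (rule sum_mono)
      fix j assume j: "j \<in> {-int J..int J}"
      show "card (?S j) \<le> card ?E"
      proof (rule card_inj_on_le)
        show "inj_on (\<lambda>n. nat (int n + j)) (?S j)" using j by (auto simp: inj_on_def)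
        show "(\<lambda>n. nat (int n + j)) ` ?S j \<subseteq> ?E" using j by auto
      qed simp
    qed
    also have "\<dots> = (2 * J + 1) * card ?E"
    proof -
      have "nat (2 * int J + 1) = 2 * J + 1" by linarith
      then show ?thesis by simp
    qed
    finally have "real (card {n\<in>{1..N}. \<not> good n}) \<le> real (J + (2 * J + 1) * card ?E)"
      by (simp only: card_atLeastAtMost of_nat_le_iff) simp
    also have "\<dots> = real J + (2 * real J + 1) * real (card ?E)" by (simp only: of_nat_add of_nat_mult) simp
    also have "\<dots> \<le> real J + (2 * real J + 1) * (e' * real (N + J))"
      by (intro add_left_mono mult_left_mono card) simp
    finally show ?thesis .
  qed
  show "\<exists>r>0. \<exists>G. (\<forall>n. G (n + r) = G n) \<and>
     (\<forall>\<^sub>F N in sequentially. (\<Sum>n=1..N. \<bar>h (orbit_point f n) - G n\<bar>) \<le> e * real N)"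
  proof (intro exI conjI allI)
    show "r > 0" by (rule r)
    show "G (n + r) = G n" for n unfolding G_def mod_add_self2 ..
    have "\<forall>\<^sub>F N in sequentially. 2 * B * real J + e / 4 * real J \<le> e / 4 * real N"
      using e by real_asymp
    then show "\<forall>\<^sub>F N in sequentially. (\<Sum>n=1..N. \<bar>h (orbit_point f n) - G n\<bar>) \<le> e * real N"
    proof eventually_elim
      case (elim N)
      have "(\<Sum>n=1..N. \<bar>a n - G n\<bar>) \<le> (\<Sum>n=1..N. e / 2 + (if good n then 0 else 2 * B))"
      proof (rule sum_mono)
        show "\<bar>a n - G n\<bar> \<le> e / 2 + (if good n then 0 else 2 * B)" for n
          using G_close[of n] aB[of n] G_le[of n] e by auto
      qed
      also have "\<dots> = e / 2 * real N + 2 * B * real (card {n\<in>{1..N}. \<not> good n})"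
      proof -
        have "(\<Sum>n=1..N. if good n then 0 else 2 * B) = (\<Sum>n\<in>{n\<in>{1..N}. \<not> good n}. 2 * B)"
          by (rule sum.mono_neutral_cong_right) auto
        then show ?thesis by (simp add: sum.distrib)
      qed
      also have "\<dots> \<le> e / 2 * real N + 2 * B * (real J + (2 * real J + 1) * (e' * real (N + J)))"
        using B(1) by (intro add_left_mono mult_left_mono bad) simp
      also have "2 * B * (real J + (2 * real J + 1) * (e' * real (N + J)))
          = 2 * B * real J + B / (B + 1) * (e / 4 * real (N + J))"
        using B(1) by (simp add: e'_def divide_simps) (simp add: algebra_simps)
      also have "B / (B + 1) * (e / 4 * real (N + J)) \<le> 1 * (e / 4 * real (N + J))"
        using B(1) e by (intro mult_right_mono) auto
      also have "e / 2 * real N + (2 * B * real J + 1 * (e / 4 * real (N + J))) \<le> e * real N"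
      proof -
        have "e / 4 * real (N + J) = e / 4 * real N + e / 4 * real J" by (simp add: distrib_left)
        then show ?thesis using elim by (simp add: field_simps)
      qed
      finally show ?case by (simp add: a_def)
    qed
  qed
qed

lemma observable_mean:
  assumes h: "continuous_on X (h :: _ \<Rightarrow> real)"
  obtains c where "(\<lambda>N. (\<Sum>n=1..N. h (orbit_point f n)) / real N) \<longlonglongrightarrow> c"
    "\<And>e. e > 0 \<Longrightarrow> \<exists>r>0. \<forall>\<^sub>F N in sequentially.
       (\<Sum>n=1..N. \<bar>(\<Sum>i<r. h (orbit_point f (n + i))) / real r - c\<bar>) \<le> e * real N"
proof -
  obtain B where "B \<ge> 0" and B: "\<And>x. x \<in> X \<Longrightarrow> \<bar>h x\<bar> \<le> B" by (rule continuous_bounded[OF h]) blast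
  from B[OF orbit_point_in_closure] have "\<bar>h (orbit_point f n)\<bar> \<le> B" for n .
  then show thesis
    using mean_almost_periodic_mean[of "\<lambda>n. h (orbit_point f n)" B thesis]
      mean_almost_periodic_observable[OF h] that by blast
qed

lemma integral_empirical_measure_orbit_point:
  assumes "continuous_on X (h :: _ \<Rightarrow> real)"
  shows "(\<integral>x. h x \<partial>empirical_measure f N) = (\<Sum>n=1..N. h (orbit_point f n)) / real N"
  using integral_empirical_measure[OF assms, of N] by (simp add: orbit_point_def)

end

section \<open>Ergodicity\<close>

text \<open>The cutoffs are 1 on \<open>C\<close> and vanish at x once n exceeds the reciprocal of
  the distance from x to \<open>C\<close>, which is positive off the closed set. Dominated
  convergence gives the limit in mean.\<close>

lemma infdist_cutoff_tendsto:
  fixes M :: "'a::metric_space measure"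
  assumes M: "prob_space M" "sets M = sets borel" and C: "closed C" "C \<noteq> {}"
  shows "(\<lambda>n. \<integral>x. \<bar>max 0 (1 - real n * infdist x C) - indicat_real C x\<bar> \<partial>M) \<longlonglongrightarrow> 0"
proof -
  interpret prob_space M by (rule M)
  let ?h = "\<lambda>n x. max 0 (1 - real n * infdist x C)"
  have meas: "?h n \<in> borel_measurable M" for n
    unfolding measurable_cong_sets[OF M(2) refl]
    by (intro borel_measurable_continuous_onI continuous_intros)
  have [measurable]: "C \<in> sets M" using C(1) M(2) by simp
  have "(\<lambda>n. \<integral>x. \<bar>?h n x - indicat_real C x\<bar> \<partial>M) \<longlonglongrightarrow> (\<integral>x. 0 \<partial>M)"
  proof (rule integral_dominated_convergence[where w = "\<lambda>_. 1"])
    show "(\<lambda>x. \<bar>?h n x - indicat_real C x\<bar>) \<in> borel_measurable M" for n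
      using meas[of n] by measurable
    show "AE x in M. (\<lambda>n. \<bar>?h n x - indicat_real C x\<bar>) \<longlonglongrightarrow> 0"
    proof (rule AE_I2)
      fix x
      show "(\<lambda>n. \<bar>?h n x - indicat_real C x\<bar>) \<longlonglongrightarrow> 0"
      proof (cases "x \<in> C")
        case True
        then show ?thesis by simp
      next
        case False
        then have "infdist x C > 0"
          using in_closed_iff_infdist_zero[OF C] infdist_nonneg[of x C] by (simp add: less_le)
        then obtain k :: nat where "1 < real k * infdist x C" using reals_Archimedean3 by blast
        have "\<bar>?h n x - indicat_real C x\<bar> = 0" if "n \<ge> k" for n
        proof -
          have "real k * infdist x C \<le> real n * infdist x C"
            using that infdist_nonneg by (intro mult_right_mono) auto
          then show ?thesis using \<open>1 < real k * infdist x C\<close> False by simp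
        qed
        then show ?thesis by (intro tendsto_eventually) (auto simp: eventually_sequentially)
      qed
    qed
    show "AE x in M. norm \<bar>?h n x - indicat_real C x\<bar> \<le> 1" for n
    proof (rule AE_I2)
      fix x
      have "real n * infdist x C \<ge> 0" by (simp add: infdist_nonneg)
      then show "norm \<bar>?h n x - indicat_real C x\<bar> \<le> 1"
        by (cases "x \<in> C") auto
    qed
  qed auto
  then show ?thesis by simp
qed

lemma integrable_infdist_cutoff:
  fixes M :: "'a::metric_space measure"
  assumes "prob_space M" "sets M = sets borel"
  shows "integrable M (\<lambda>x. max 0 (1 - real n * infdist x C))"
proof -
  interpret prob_space M by (rule assms)
  have "(\<lambda>x. max 0 (1 - real n * infdist x C)) \<in> borel_measurable M"
    unfolding measurable_cong_sets[OF assms(2) refl]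
    by (intro borel_measurable_continuous_onI continuous_intros)
  then show ?thesis
    by (intro integrable_const_bound[where B = 1]) (auto simp: infdist_nonneg)
qed

text \<open>Integrals of the cutoffs recover the measure of every closed set, and closed sets form
  an intersection-stable generator of the Borel sets.\<close>

lemma borel_measure_eqI_continuous:
  fixes M N :: "'a::metric_space measure"
  assumes M: "prob_space M" "sets M = sets borel" and N: "prob_space N" "sets N = sets borel"
    and eq: "\<And>h::'a \<Rightarrow> real. continuous_on UNIV h \<Longrightarrow> (\<integral>x. h x \<partial>M) = (\<integral>x. h x \<partial>N)"
  shows "M = N"
proof -
  interpret M: prob_space M by (rule M)
  interpret N: prob_space N by (rule N)
  have lim: "(\<lambda>n. \<integral>x. max 0 (1 - real n * infdist x C) \<partial>K) \<longlonglongrightarrow> measure K C"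
    if K: "prob_space K" "sets K = sets borel" and C: "closed C" "C \<noteq> {}" for K C
  proof -
    interpret K: prob_space K by (rule K)
    have [measurable]: "C \<in> sets K" using C(1) K(2) by simp
    have int: "integrable K (indicat_real C)"
      by (intro integrable_real_indicator) (auto simp: K.emeasure_eq_measure)
    have "(\<lambda>n. (\<integral>x. max 0 (1 - real n * infdist x C) \<partial>K) - measure K C) \<longlonglongrightarrow> 0"
    proof (rule Lim_null_comparison[OF _ infdist_cutoff_tendsto[OF K C]], rule always_eventually, rule allI)
      fix n
      have "(\<integral>x. max 0 (1 - real n * infdist x C) \<partial>K) - measure K C
          = (\<integral>x. max 0 (1 - real n * infdist x C) - indicat_real C x \<partial>K)"
        using int integrable_infdist_cutoff[OF K] by simp
      also have "norm \<dots> \<le> (\<integral>x. \<bar>max 0 (1 - real n * infdist x C) - indicat_real C x\<bar> \<partial>K)"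
        using integral_norm_bound[of K "\<lambda>x. max 0 (1 - real n * infdist x C) - indicat_real C x"] by simp
      finally show "norm ((\<integral>x. max 0 (1 - real n * infdist x C) \<partial>K) - measure K C)
          \<le> (\<integral>x. \<bar>max 0 (1 - real n * infdist x C) - indicat_real C x\<bar> \<partial>K)" .
    qed
    then show ?thesis by (simp add: LIM_zero_iff)
  qed
  show ?thesis
  proof (rule measure_eqI_generator_eq)
    show "Int_stable {C :: 'a set. closed C}" by (auto simp: Int_stable_def)
    show "emeasure M C = emeasure N C" if "C \<in> {C. closed C}" for C
    proof (cases "C = {}")
      case False
      have "continuous_on UNIV (\<lambda>x. max 0 (1 - real n * infdist x C))" for n
        by (intro continuous_intros)
      then have "(\<lambda>n. \<integral>x. max 0 (1 - real n * infdist x C) \<partial>N) \<longlonglongrightarrow> measure M C"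
        using lim[OF M, of C] that False eq by simp
      then have "measure M C = measure N C"
        using lim[OF N, of C] that False LIMSEQ_unique by auto
      then show ?thesis by (simp add: M.emeasure_eq_measure N.emeasure_eq_measure)
    qed simp
    show "sets M = sigma_sets UNIV {C. closed C}" using M(2) by (simp add: borel_eq_closed)
    show "sets N = sigma_sets UNIV {C. closed C}" using N(2) by (simp add: borel_eq_closed)
    show "range (\<lambda>_. UNIV) \<subseteq> {C :: 'a set. closed C}" "(\<Union>i. (\<lambda>_. UNIV) i) = (UNIV :: 'a set)" by auto
  qed auto
qed

text \<open>Inner regularity on a Polish space replaces \<open>A\<close> by a compact subset
  \<open>K\<close>, losing at most e/2; a cutoff around \<open>K\<close> costs another e/2.\<close>

lemma continuous_approximation_of_set:
  fixes M :: "'a::polish_space measure"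
  assumes M: "prob_space M" "sets M = sets borel" and A: "A \<in> sets borel" and e: "e > 0"
  obtains h where "continuous_on UNIV h" "\<And>x. 0 \<le> h x" "\<And>x. h x \<le> 1"
    "(\<integral>x. \<bar>indicat_real A x - h x\<bar> \<partial>M) \<le> e"
proof (cases "emeasure M A = 0")
  case True
  interpret prob_space M by (rule M)
  have "AE x in M. x \<notin> A" using True A M(2) by (intro AE_not_in) (auto simp: null_sets_def)
  then have "(\<integral>x. \<bar>indicat_real A x - 0\<bar> \<partial>M) = (\<integral>x. 0 \<partial>M)"
    using A M(2) by (intro integral_cong_AE) auto
  then show thesis using e by (intro that[of "\<lambda>_. 0"]) auto
next
  case False
  interpret prob_space M by (rule M)
  have [measurable]: "A \<in> sets M" using A M(2) by simp
  \<comment> \<open>The minimum with \<open>measure M A\<close> keeps \<open>measure M A - d\<close>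
    nonnegative, so that \<open>K\<close> has positive measure and is nonempty.\<close>
  define d where "d = min (measure M A) (e / 2)"
  have "measure M A > 0" using False by (simp add: emeasure_eq_measure less_le)
  then have d: "d > 0" using e by (simp add: d_def)
  have "emeasure M A = (SUP K\<in>{K. K \<subseteq> A \<and> compact K}. emeasure M K)"
    using inner_regular[OF M(2) _ A] emeasure_space_1 by simp
  moreover have "ennreal (measure M A - d) < emeasure M A"
    using d \<open>measure M A > 0\<close> by (simp add: emeasure_eq_measure ennreal_less_iff d_def)
  ultimately obtain K where K: "K \<subseteq> A" "compact K" "ennreal (measure M A - d) < emeasure M K"
    by (auto simp: less_SUP_iff)
  then have mK: "measure M A - d < measure M K"
    by (simp add: emeasure_eq_measure ennreal_less_iff d_def)
  have "K \<noteq> {}" using mK by (auto simp: d_def)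
  have cK: "closed K" using K(2) by (rule compact_imp_closed)
  have [measurable]: "K \<in> sets M" using cK M(2) by simp
  let ?h = "\<lambda>n x. max 0 (1 - real n * infdist x K)"
  have "\<forall>\<^sub>F n in sequentially. (\<integral>x. \<bar>?h n x - indicat_real K x\<bar> \<partial>M) < e / 2"
    using order_tendstoD(2)[OF infdist_cutoff_tendsto[OF M cK \<open>K \<noteq> {}\<close>], of "e / 2"] e by simp
  then obtain n where n: "(\<integral>x. \<bar>?h n x - indicat_real K x\<bar> \<partial>M) < e / 2"
    by (auto simp: eventually_sequentially)
  have int: "integrable M (?h n)" "integrable M (indicat_real K)" "integrable M (indicat_real A)"
    using integrable_infdist_cutoff[OF M]
    by (auto intro!: integrable_real_indicator simp: emeasure_eq_measure)
  show thesis
  proof (rule that[of "?h n"])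
    show "continuous_on UNIV (?h n)" by (intro continuous_intros)
    show "0 \<le> ?h n x" for x by simp
    show "?h n x \<le> 1" for x by (simp add: infdist_nonneg)
    have "(\<integral>x. \<bar>indicat_real A x - ?h n x\<bar> \<partial>M)
        \<le> (\<integral>x. (indicat_real A x - indicat_real K x) + \<bar>?h n x - indicat_real K x\<bar> \<partial>M)"
    proof (rule integral_mono)
      fix x
      show "\<bar>indicat_real A x - ?h n x\<bar>
          \<le> (indicat_real A x - indicat_real K x) + \<bar>?h n x - indicat_real K x\<bar>"
        using K(1) by (auto simp: indicator_def)
    qed (intro integrable_abs Bochner_Integration.integrable_add Bochner_Integration.integrable_diff int)+
    also have "\<dots> = measure M A - measure M K + (\<integral>x. \<bar>?h n x - indicat_real K x\<bar> \<partial>M)"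
      using int by simp
    also have "\<dots> \<le> e" using n mK by (simp add: d_def)
    finally show "(\<integral>x. \<bar>indicat_real A x - ?h n x\<bar> \<partial>M) \<le> e" .
  qed
qed

section \<open>Shift invariance and invariant sets of a Furstenberg system\<close>

context finite_valued_near_periodic
begin

lemma furstenberg_system_space:
  assumes "furstenberg_system f \<nu>"
  shows "prob_space \<nu>" "sets \<nu> = sets (restrict_space borel X)" "space \<nu> = X"
proof -
  show "prob_space \<nu>" and s: "sets \<nu> = sets (restrict_space borel X)"
    using assms unfolding furstenberg_system_def weak_star_tendsto_def by blast+
  show "space \<nu> = X" using sets_eq_imp_space_eq[OF s] by (simp add: space_restrict_space)
qed

text \<open>Membership in a closed set survives the limit along the subsequence; with
  \<open>{..e}\<close> this carries bounds for orbit averages over to integrals.\<close>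

lemma integral_furstenberg_system:
  assumes "furstenberg_system f \<nu>" and h: "continuous_on X (h :: _ \<Rightarrow> real)"
    and P: "closed S" "\<forall>\<^sub>F N in sequentially. (\<Sum>n=1..N. h (orbit_point f n)) / real N \<in> S"
  shows "(\<integral>x. h x \<partial>\<nu>) \<in> S"
proof -
  obtain N :: "nat \<Rightarrow> nat" where N: "filterlim N at_top sequentially"
    and lim: "(\<lambda>k. \<integral>x. h x \<partial>empirical_measure f (N k)) \<longlonglongrightarrow> (\<integral>x. h x \<partial>\<nu>)"
    using assms(1) h unfolding furstenberg_system_def weak_star_tendsto_def by blast
  have "\<forall>\<^sub>F k in sequentially. (\<integral>x. h x \<partial>empirical_measure f (N k)) \<in> S"
    using eventually_compose_filterlim[OF P(2) N]
    by (simp add: integral_empirical_measure_orbit_point[OF h])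
  then show ?thesis using Lim_in_closed_set[OF P(1) _ _ lim] by simp
qed

lemma measurable_left_shift:
  assumes "furstenberg_system f \<nu>"
  shows "left_shift \<in> measurable \<nu> \<nu>"
proof -
  note sets = furstenberg_system_space(2)[OF assms]
  have "left_shift \<in> measurable (restrict_space borel X) borel"
    by (rule borel_measurable_continuous_on_restrict[OF continuous_on_left_shift])
  then have "left_shift \<in> measurable (restrict_space borel X) (restrict_space borel X)"
    by (intro measurable_restrict_space2) (auto simp: space_restrict_space left_shift_in_orbit_closure)
  then show ?thesis by (simp only: measurable_cong_sets[OF sets sets])
qed

lemma integral_furstenberg_system_eq_mean:
  assumes "furstenberg_system f \<nu>" and h: "continuous_on X (h :: _ \<Rightarrow> real)"
    and c: "(\<lambda>N. (\<Sum>n=1..N. h (orbit_point f n)) / real N) \<longlonglongrightarrow> c"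
  shows "(\<integral>x. h x \<partial>\<nu>) = c"
proof -
  obtain N :: "nat \<Rightarrow> nat" where N: "filterlim N at_top sequentially"
    and lim: "(\<lambda>k. \<integral>x. h x \<partial>empirical_measure f (N k)) \<longlonglongrightarrow> (\<integral>x. h x \<partial>\<nu>)"
    using assms(1) h unfolding furstenberg_system_def weak_star_tendsto_def by blast
  have "(\<lambda>k. \<integral>x. h x \<partial>empirical_measure f (N k)) \<longlonglongrightarrow> c"
    using filterlim_compose[OF c N] by (simp add: integral_empirical_measure_orbit_point[OF h])
  with lim show ?thesis by (rule LIMSEQ_unique)
qed

lemma continuous_on_comp_left_shift:
  assumes "continuous_on X h"
  shows "continuous_on X (\<lambda>x. h (left_shift x))"
  by (rule continuous_on_compose2[OF assms continuous_on_left_shift])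
    (auto intro: left_shift_in_orbit_closure)

text \<open>Along the orbit, composing \<open>h\<close> with the shift moves the index by one, which
  changes the N-th average by at most 2B/N.\<close>

lemma integral_left_shift:
  assumes FS: "furstenberg_system f \<nu>" and h: "continuous_on X (h :: _ \<Rightarrow> real)"
  shows "(\<integral>x. h (left_shift x) \<partial>\<nu>) = (\<integral>x. h x \<partial>\<nu>)"
proof -
  obtain c where c: "(\<lambda>N. (\<Sum>n=1..N. h (orbit_point f n)) / real N) \<longlonglongrightarrow> c"
    by (rule observable_mean[OF h]) blast
  obtain B where B: "B \<ge> 0" "\<And>x. x \<in> X \<Longrightarrow> \<bar>h x\<bar> \<le> B" by (rule continuous_bounded[OF h]) blast
  let ?a = "\<lambda>n. h (orbit_point f n)"
  have aB: "\<bar>?a n\<bar> \<le> B" for n by (rule B(2)[OF orbit_point_in_closure])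
  have "(\<lambda>N. (\<Sum>n=1..N. ?a (n + 1)) / real N - (\<Sum>n=1..N. ?a n) / real N) \<longlonglongrightarrow> 0"
  proof (rule Lim_null_comparison)
    show "(\<lambda>N. 2 * B / real N) \<longlonglongrightarrow> 0" by real_asymp
    have "\<bar>(\<Sum>n=1..N. ?a (n + 1)) / real N - (\<Sum>n=1..N. ?a n) / real N\<bar> \<le> 2 * B / real N" for N
    proof -
      have "\<bar>(\<Sum>n=1..N. ?a (n + 1)) - (\<Sum>n=1..N. ?a n)\<bar> \<le> 2 * B"
        using sum_shift_diff_le[where a = ?a and B = B and N = N and i = 1] aB by simp
      then have "\<bar>((\<Sum>n=1..N. ?a (n + 1)) - (\<Sum>n=1..N. ?a n)) / real N\<bar> \<le> 2 * B / real N"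
        unfolding abs_divide abs_of_nat by (rule divide_right_mono) simp
      then show ?thesis by (simp only: diff_divide_distrib)
    qed
    then show "\<forall>\<^sub>F N in sequentially.
        norm ((\<Sum>n=1..N. ?a (n + 1)) / real N - (\<Sum>n=1..N. ?a n) / real N) \<le> 2 * B / real N"
      by simp
  qed
  from tendsto_add[OF this c]
  have "(\<lambda>N. (\<Sum>n=1..N. h (left_shift (orbit_point f n))) / real N) \<longlonglongrightarrow> c"
    by (simp add: left_shift_orbit_point)
  then have "(\<integral>x. h (left_shift x) \<partial>\<nu>) = c"
    by (rule integral_furstenberg_system_eq_mean[OF FS continuous_on_comp_left_shift[OF h]])
  moreover have "(\<integral>x. h x \<partial>\<nu>) = c" by (rule integral_furstenberg_system_eq_mean[OF FS h c])
  ultimately show ?thesis by simp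
qed

text \<open>\<open>\<nu>\<close> lives on the trace \<sigma>-algebra of \<open>X\<close>, whereas
  the approximation lemmas speak of Borel measures on the whole space. The inclusion mediates, and
  \<open>X\<close> being closed makes measurable subsets of \<open>X\<close> Borel.\<close>

lemma furstenberg_system_borel:
  assumes FS: "furstenberg_system f \<nu>"
  shows "(\<lambda>x. x) \<in> measurable \<nu> borel"
    "A \<in> sets \<nu> \<Longrightarrow> A \<subseteq> X \<and> A \<in> sets borel"
proof -
  note sets = furstenberg_system_space(2)[OF FS]
  show "(\<lambda>x. x) \<in> measurable \<nu> borel"
    unfolding measurable_cong_sets[OF sets refl]
    by (intro borel_measurable_continuous_on_restrict continuous_on_id)
  show "A \<in> sets \<nu> \<Longrightarrow> A \<subseteq> X \<and> A \<in> sets borel"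
    unfolding sets using closed_orbit_closure by (subst (asm) sets_restrict_space_iff) auto
qed

text \<open>Both measures are pushed forward to the whole space, compared there on continuous
  functions, and restricted to subsets of \<open>X\<close> again.\<close>

lemma distr_left_shift:
  assumes FS: "furstenberg_system f \<nu>"
  shows "distr \<nu> \<nu> left_shift = \<nu>"
proof -
  interpret prob_space \<nu> by (rule furstenberg_system_space[OF FS])
  have S: "left_shift \<in> measurable \<nu> \<nu>" by (rule measurable_left_shift[OF FS])
  have id: "(\<lambda>x. x) \<in> measurable \<nu> borel" by (rule furstenberg_system_borel[OF FS])
  have S': "left_shift \<in> measurable \<nu> borel" using measurable_compose[OF S id] by simp
  have eq: "distr \<nu> borel left_shift = distr \<nu> borel (\<lambda>x. x)"
  proof (rule borel_measure_eqI_continuous)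
    fix h :: "(int \<Rightarrow> complex) \<Rightarrow> real" assume h: "continuous_on UNIV h"
    have "h \<in> borel_measurable borel" using h by (rule borel_measurable_continuous_onI)
    then show "(\<integral>x. h x \<partial>distr \<nu> borel left_shift) = (\<integral>x. h x \<partial>distr \<nu> borel (\<lambda>x. x))"
      using integral_left_shift[OF FS continuous_on_subset[OF h]] S' id by (simp add: integral_distr)
  qed (auto intro: prob_space_distr S' id)
  show ?thesis
  proof (rule measure_eqI)
    fix A assume "A \<in> sets (distr \<nu> \<nu> left_shift)"
    then have A: "A \<in> sets \<nu>" by simp
    then have "A \<in> sets borel" "A \<subseteq> space \<nu>"
      using furstenberg_system_borel(2)[OF FS] furstenberg_system_space(3)[OF FS] by auto
    then have "emeasure (distr \<nu> \<nu> left_shift) A = emeasure (distr \<nu> borel left_shift) A"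
      using A S S' by (simp add: emeasure_distr)
    also have "\<dots> = emeasure \<nu> A"
      unfolding eq using id \<open>A \<in> sets borel\<close> \<open>A \<subseteq> space \<nu>\<close>
      by (simp add: emeasure_distr Int_absorb2)
    finally show "emeasure (distr \<nu> \<nu> left_shift) A = emeasure \<nu> A" .
  qed simp
qed

lemma integral_left_shift_iterate:
  assumes FS: "furstenberg_system f \<nu>" and g: "g \<in> borel_measurable \<nu>"
  shows "(\<integral>x. g ((left_shift ^^ i) x) \<partial>\<nu>) = (\<integral>x. (g x :: real) \<partial>\<nu>)"
proof (induction i)
  case (Suc i)
  note S = measurable_left_shift[OF FS]
  have Si: "(left_shift ^^ i) \<in> measurable \<nu> \<nu>" using S by (rule measurable_compose_n)
  have "(\<integral>x. g ((left_shift ^^ Suc i) x) \<partial>\<nu>) = (\<integral>x. g ((left_shift ^^ i) (left_shift x)) \<partial>\<nu>)"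
    by (simp add: funpow_swap1)
  also have "\<dots> = (\<integral>x. g ((left_shift ^^ i) x) \<partial>distr \<nu> \<nu> left_shift)"
    using S measurable_compose[OF Si g] by (simp add: integral_distr)
  also have "\<dots> = (\<integral>x. g x \<partial>\<nu>)" by (simp add: distr_left_shift[OF FS] Suc)
  finally show ?case .
qed simp

text \<open>
  Block averages of a continuous function are close in mean to a constant, so an invariant
  indicator function, being its own block average, is close to a constant.
\<close>

lemma invariant_set_trivial:
  assumes FS: "furstenberg_system f \<nu>" and A: "A \<in> sets \<nu>" and inv: "left_shift -` A \<inter> space \<nu> = A"
  shows "measure \<nu> A = 0 \<or> measure \<nu> A = 1"
proof -
  interpret prob_space \<nu> by (rule furstenberg_system_space[OF FS])
  note sp = furstenberg_system_space(3)[OF FS]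
  have A': "A \<subseteq> X" "A \<in> sets borel" using furstenberg_system_borel(2)[OF FS A] by auto
  have id: "(\<lambda>x. x) \<in> measurable \<nu> borel" by (rule furstenberg_system_borel[OF FS])
  define p where "p = measure \<nu> A"
  have p: "0 \<le> p" "p \<le> 1" by (simp_all add: p_def)
  have intA: "integrable \<nu> (indicat_real A)"
    using A by (intro integrable_real_indicator) (auto simp: emeasure_eq_measure)
  have pA: "(\<integral>x. indicat_real A x \<partial>\<nu>) = p" using A by (simp add: p_def)
  \<comment> \<open>Here 2e comes from the estimate of p (1 - c), and one more e from replacing c by
    p.\<close>
  have bound: "p * (1 - p) \<le> 3 * e" if e: "e > 0" for e
  proof -
    obtain h where h: "continuous_on UNIV h" "\<And>x. 0 \<le> h x" "\<And>x. h x \<le> (1::real)"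
      and approx': "(\<integral>x. \<bar>indicat_real A x - h x\<bar> \<partial>distr \<nu> borel (\<lambda>x. x)) \<le> e"
      using continuous_approximation_of_set[OF prob_space_distr[OF id] sets_distr A'(2) e] by blast
    have hb: "h \<in> borel_measurable borel" by (rule borel_measurable_continuous_onI[OF h(1)])
    have hm: "h \<in> borel_measurable \<nu>" using measurable_compose[OF id hb] .
    have approx: "(\<integral>x. \<bar>indicat_real A x - h x\<bar> \<partial>\<nu>) \<le> e"
      using approx' id hb A'(2) by (subst (asm) integral_distr) auto
    have inth: "integrable \<nu> h"
      using hm h by (intro integrable_const_bound[where B = 1]) auto
    have hX: "continuous_on X h" using h(1) by (rule continuous_on_subset) simp
    obtain c where c: "(\<lambda>N. (\<Sum>n=1..N. h (orbit_point f n)) / real N) \<longlonglongrightarrow> c"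
      and bl: "\<exists>r>0. \<forall>\<^sub>F N in sequentially.
         (\<Sum>n=1..N. \<bar>(\<Sum>i<r. h (orbit_point f (n + i))) / real r - c\<bar>) \<le> e * real N"
      by (rule observable_mean[OF hX]) (use e in blast)
    obtain r where r: "r > 0" and bl: "\<forall>\<^sub>F N in sequentially.
         (\<Sum>n=1..N. \<bar>(\<Sum>i<r. h (orbit_point f (n + i))) / real r - c\<bar>) \<le> e * real N"
      using bl by blast
    have "(\<integral>x. h x \<partial>\<nu>) = c" by (rule integral_furstenberg_system_eq_mean[OF FS hX c])
    then have "p - c = (\<integral>x. indicat_real A x - h x \<partial>\<nu>)" using intA inth pA by simp
    also have "\<bar>\<dots>\<bar> \<le> (\<integral>x. \<bar>indicat_real A x - h x\<bar> \<partial>\<nu>)"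
      using integral_norm_bound[of \<nu> "\<lambda>x. indicat_real A x - h x"] by simp
    finally have pc: "\<bar>p - c\<bar> \<le> e" using approx by linarith
    \<comment> \<open>\<open>K\<close> is continuous on \<open>X\<close>, so the mean bound for
      block averages along the orbit becomes a bound for its integral.\<close>
    define K where "K x = \<bar>(\<Sum>i<r. h ((left_shift ^^ i) x)) / real r - c\<bar>" for x
    have Si_cont: "continuous_on X (\<lambda>x. h ((left_shift ^^ i) x))" for i
    proof (induction i)
      case (Suc i)
      then show ?case using continuous_on_comp_left_shift[OF Suc] by (simp add: funpow_swap1)
    qed (simp add: hX)
    have Kc: "continuous_on X K" unfolding K_def using r by (intro continuous_intros Si_cont) auto
    have orb: "(left_shift ^^ i) (orbit_point f n) = orbit_point f (n + i)" for i n
      by (induction i) (simp_all add: left_shift_orbit_point)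
    have intK: "(\<integral>x. K x \<partial>\<nu>) \<le> e"
    proof -
      have "\<forall>\<^sub>F N in sequentially. (\<Sum>n=1..N. K (orbit_point f n)) / real N \<in> {..e}"
        using bl eventually_gt_at_top[of 0]
        by eventually_elim (simp add: K_def orb pos_divide_le_eq)
      from integral_furstenberg_system[OF FS Kc _ this] show ?thesis by simp
    qed
    have meas_Si: "(left_shift ^^ i) \<in> measurable \<nu> \<nu>" for i
      using measurable_left_shift[OF FS] by (rule measurable_compose_n)
    have hSi: "integrable \<nu> (\<lambda>x. h ((left_shift ^^ i) x))" for i
      using measurable_compose[OF meas_Si hm] h by (intro integrable_const_bound[where B = 1]) auto
    have AS: "indicat_real A ((left_shift ^^ i) x) = indicat_real A x" if "x \<in> space \<nu>" for x i
      using that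
    proof (induction i arbitrary: x)
      case (Suc i)
      have "left_shift x \<in> space \<nu>" using Suc.prems sp left_shift_in_orbit_closure by simp
      then have "indicat_real A ((left_shift ^^ i) (left_shift x)) = indicat_real A (left_shift x)"
        by (rule Suc.IH)
      also have "\<dots> = indicat_real A x" using inv Suc.prems by (auto simp: indicator_def)
      finally show ?case by (simp add: funpow_swap1)
    qed simp
    \<comment> \<open>By invariance of \<open>A\<close> and of \<open>\<nu>\<close>, every iterate
      of \<open>h\<close> approximates the indicator as well as \<open>h\<close> does.\<close>
    have AhSi: "(\<integral>x. \<bar>indicat_real A x - h ((left_shift ^^ i) x)\<bar> \<partial>\<nu>) \<le> e" for i
    proof -
      have "(\<integral>x. \<bar>indicat_real A x - h ((left_shift ^^ i) x)\<bar> \<partial>\<nu>)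
          = (\<integral>x. \<bar>indicat_real A ((left_shift ^^ i) x) - h ((left_shift ^^ i) x)\<bar> \<partial>\<nu>)"
        by (intro Bochner_Integration.integral_cong) (simp_all add: AS)
      also have "\<dots> = (\<integral>x. \<bar>indicat_real A x - h x\<bar> \<partial>\<nu>)"
        using integral_left_shift_iterate[OF FS, of "\<lambda>x. \<bar>indicat_real A x - h x\<bar>" i] A hm by simp
      finally show ?thesis using approx by simp
    qed
    have Kint: "integrable \<nu> K" unfolding K_def
      by (intro integrable_abs Bochner_Integration.integrable_diff integrable_divide
            Bochner_Integration.integrable_sum hSi) auto
    have "p * (1 - c) = (\<integral>x. indicat_real A x * (1 - c) \<partial>\<nu>)" using pA by simp
    \<comment> \<open>On \<open>A\<close> one writes 1 - c = (1 - m) + (m - c) with the block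
      average m at x; off \<open>A\<close> the left side is 0.\<close>
    also have "\<dots> \<le> (\<integral>x. (\<Sum>i<r. \<bar>indicat_real A x - h ((left_shift ^^ i) x)\<bar> / real r) + K x \<partial>\<nu>)"
    proof (rule integral_mono)
      show "integrable \<nu> (\<lambda>x. indicat_real A x * (1 - c))" using intA by simp
      show "integrable \<nu> (\<lambda>x. (\<Sum>i<r. \<bar>indicat_real A x - h ((left_shift ^^ i) x)\<bar> / real r) + K x)"
        by (intro Bochner_Integration.integrable_add Bochner_Integration.integrable_sum
             integrable_divide integrable_abs Bochner_Integration.integrable_diff hSi intA Kint)
      fix x
      let ?m = "(\<Sum>i<r. h ((left_shift ^^ i) x)) / real r"
      have "indicat_real A x - ?m = (\<Sum>i<r. (indicat_real A x - h ((left_shift ^^ i) x)) / real r)"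
        using r by (simp add: sum_divide_distrib[symmetric] sum_subtractf diff_divide_distrib)
      also have "\<dots> \<le> (\<Sum>i<r. \<bar>indicat_real A x - h ((left_shift ^^ i) x)\<bar> / real r)"
        by (intro sum_mono divide_right_mono) auto
      finally have *: "indicat_real A x - ?m \<le> (\<Sum>i<r. \<bar>indicat_real A x - h ((left_shift ^^ i) x)\<bar> / real r)" .
      have nonneg: "0 \<le> (\<Sum>i<r. \<bar>indicat_real A x - h ((left_shift ^^ i) x)\<bar> / real r)"
        by (intro sum_nonneg) simp
      show "indicat_real A x * (1 - c) \<le> (\<Sum>i<r. \<bar>indicat_real A x - h ((left_shift ^^ i) x)\<bar> / real r) + K x"
      proof (cases "x \<in> A")
        case True
        then have "indicat_real A x * (1 - c) = (indicat_real A x - ?m) + (?m - c)" by simp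
        also have "\<dots> \<le> (\<Sum>i<r. \<bar>indicat_real A x - h ((left_shift ^^ i) x)\<bar> / real r) + K x"
          by (intro add_mono *) (simp add: K_def)
        finally show ?thesis .
      next
        case False
        then show ?thesis using nonneg by (simp add: K_def)
      qed
    qed
    also have "\<dots> = (\<Sum>i<r. (\<integral>x. \<bar>indicat_real A x - h ((left_shift ^^ i) x)\<bar> \<partial>\<nu>) / real r) + (\<integral>x. K x \<partial>\<nu>)"
      using hSi intA Kint by (simp add: Bochner_Integration.integral_sum)
    also have "\<dots> \<le> (\<Sum>i<r. e / real r) + e"
      by (intro add_mono intK sum_mono divide_right_mono AhSi) simp
    also have "\<dots> = 2 * e" using r by simp
    finally have "p * (1 - c) \<le> 2 * e" .
    moreover have "p * (1 - p) \<le> p * (1 - c) + e"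
    proof -
      have "p * (c - p) \<le> 1 * e"
      proof -
        have "p * (c - p) \<le> p * e" using pc p by (intro mult_left_mono) auto
        also have "\<dots> \<le> 1 * e" using p e by (intro mult_right_mono) auto
        finally show ?thesis .
      qed
      then show ?thesis by (simp add: algebra_simps)
    qed
    ultimately show ?thesis by simp
  qed
  have "p * (1 - p) \<le> 0"
  proof (rule field_le_epsilon)
    fix e :: real assume "e > 0"
    then show "p * (1 - p) \<le> 0 + e" using bound[of "e / 3"] by simp
  qed
  moreover have "p * (1 - p) \<ge> 0" using p by simp
  ultimately have "p * (1 - p) = 0" by linarith
  then show ?thesis by (auto simp: p_def)
qed

lemma furstenberg_system_ergodic:
  assumes "furstenberg_system f \<nu>"
  shows "ergodic_system \<nu> left_shift"
  unfolding ergodic_system_def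
  using furstenberg_system_space(1)[OF assms] measurable_left_shift[OF assms]
    distr_left_shift[OF assms] invariant_set_trivial[OF assms] by blast

end

section \<open>Existence of the limit measure\<close>

text \<open>Digits up to b in base b + 2 rule out carries: at the first difference m the terms
  differ by at least (b+2)^(-m), while everything after it amounts to at most b/(b+1) of
  this.\<close>

lemma digit_expansion_inj:
  fixes d e :: "nat \<Rightarrow> nat" and b :: nat
  assumes d: "\<And>n. d n \<le> b" and e: "\<And>n. e n \<le> b"
    and eq: "(\<Sum>n. real (d n) / real (b + 2) ^ n) = (\<Sum>n. real (e n) / real (b + 2) ^ n)"
  shows "d = e"
proof (rule ccontr)
  assume "d \<noteq> e"
  then have ex: "\<exists>n. d n \<noteq> e n" by auto
  define m where "m = (LEAST n. d n \<noteq> e n)"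
  have m: "d m \<noteq> e m" unfolding m_def using ex by (rule LeastI_ex)
  have below: "d n = e n" if "n < m" for n using not_less_Least[OF that[unfolded m_def]] by simp
  define K where "K = real (b + 2)"
  have K: "K > 1" "K = real b + 2" by (simp_all add: K_def)
  define t where "t n = (real (d n) - real (e n)) / K ^ n" for n
  have geo: "summable (\<lambda>n. (1 / K) ^ n)" using K by (intro summable_geometric) simp
  have digit_summ: "summable (\<lambda>n. real (c n) / K ^ n)" if "\<And>n. c n \<le> b" for c :: "nat \<Rightarrow> nat"
  proof (rule summable_comparison_test')
    show "summable (\<lambda>n. real b * (1 / K) ^ n)" by (intro summable_mult geo)
    show "norm (real (c n) / K ^ n) \<le> real b * (1 / K) ^ n" for n
      using that[of n] K by (simp add: power_one_over divide_right_mono)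
  qed
  have t_summ: "summable t" unfolding t_def diff_divide_distrib
    by (intro summable_diff digit_summ d e)
  have "suminf t = 0"
    unfolding t_def diff_divide_distrib
    using suminf_diff[OF digit_summ[of d, OF d] digit_summ[of e, OF e]] eq[folded K_def] by simp
  also have "suminf t = (\<Sum>n. t (n + Suc m)) + (\<Sum>n<Suc m. t n)"
    by (rule suminf_split_initial_segment[OF t_summ])
  also have "(\<Sum>n<Suc m. t n) = t m" using below by (simp add: t_def)
  finally have tm: "\<bar>t m\<bar> = \<bar>\<Sum>n. t (n + Suc m)\<bar>" by linarith
  have bound: "norm (t (n + Suc m)) \<le> real b / K ^ Suc m * (1 / K) ^ n" for n
  proof -
    have "\<bar>real (d (n + Suc m)) - real (e (n + Suc m))\<bar> \<le> real b"
      using d[of "n + Suc m"] e[of "n + Suc m"] by linarith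
    then have "\<bar>real (d (n + Suc m)) - real (e (n + Suc m))\<bar> / K ^ (n + Suc m) \<le> real b / K ^ (n + Suc m)"
      using K by (intro divide_right_mono) auto
    then show ?thesis using K by (simp add: t_def power_add power_one_over abs_divide mult_ac)
  qed
  have geo_sum: "(\<Sum>n. (1 / K) ^ n) = 1 / (1 - 1 / K)" using K by (intro suminf_geometric) simp
  have "\<bar>\<Sum>n. t (n + Suc m)\<bar> \<le> (\<Sum>n. real b / K ^ Suc m * (1 / K) ^ n)"
    using norm_suminf_le[OF bound summable_mult[OF geo]] by simp
  also have "\<dots> = real b / K ^ Suc m * (1 / (1 - 1 / K))"
    by (simp only: suminf_mult[OF geo] geo_sum)
  also have "\<dots> = real b / (real b + 1) * (1 / K ^ m)"
  proof -
    have "1 / (1 - 1 / K) = K / (real b + 1)" using K by (simp add: divide_simps)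
    then show ?thesis using K(1) by simp
  qed
  also have "\<dots> < 1 * (1 / K ^ m)"
    using K by (intro mult_strict_right_mono) auto
  also have "\<dots> \<le> \<bar>t m\<bar>"
  proof -
    have "1 \<le> \<bar>real (d m) - real (e m)\<bar>" using m by linarith
    then have "1 / K ^ m \<le> \<bar>real (d m) - real (e m)\<bar> / K ^ m"
      using K by (intro divide_right_mono) auto
    then show ?thesis using K by (simp add: t_def abs_divide)
  qed
  finally show False using tm by simp
qed

text \<open>The values are coded as digits and the sequence is read as an expansion. Each digit is
  continuous because any function on a finite set of complex numbers is, and the series converges
  uniformly.\<close>

lemma finite_valued_sequences_embed:
  fixes X :: "(int \<Rightarrow> complex) set"
  assumes F: "finite F" and X: "\<And>x j. x \<in> X \<Longrightarrow> x j \<in> F"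
  obtains \<phi> :: "(int \<Rightarrow> complex) \<Rightarrow> real" where "continuous_on X \<phi>" "inj_on \<phi> X"
proof -
  obtain c :: "complex \<Rightarrow> nat" where c: "inj_on c F" using finite_imp_inj_to_nat_seg[OF F] by auto
  define b where "b = Max (insert 0 (c ` F))"
  have cb: "c v \<le> b" if "v \<in> F" for v unfolding b_def using F that by (intro Max_ge) auto
  define \<phi> where "\<phi> x = (\<Sum>n. real (c (x (from_nat n))) / real (b + 2) ^ n)" for x :: "int \<Rightarrow> complex"
  show thesis
  proof
    have "uniform_limit X (\<lambda>N x. \<Sum>n<N. real (c (x (from_nat n))) / real (b + 2) ^ n)
        (\<lambda>x. \<Sum>n. real (c (x (from_nat n))) / real (b + 2) ^ n) sequentially"
    proof (rule Weierstrass_m_test)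
      show "summable (\<lambda>n. real b * (1 / real (b + 2)) ^ n)"
        by (intro summable_mult summable_geometric) simp
      fix n x assume "x \<in> X"
      then show "norm (real (c (x (from_nat n))) / real (b + 2) ^ n) \<le> real b * (1 / real (b + 2)) ^ n"
        using cb[OF X, of x "from_nat n"] by (simp add: power_one_over divide_right_mono)
    qed
    moreover have "continuous_on X (\<lambda>x. real (c (x (from_nat n))))" for n :: nat
    proof (rule continuous_on_compose2[of F "\<lambda>v. real (c v)"])
      show "continuous_on F (\<lambda>v. real (c v))" by (rule continuous_on_finite[OF F])
      show "continuous_on X (\<lambda>x. x (from_nat n))"
        by (rule continuous_on_subset[OF continuous_on_product_coordinates]) simp
    qed (use X in auto)
    then have "continuous_on X (\<lambda>x. \<Sum>n<N. real (c (x (from_nat n))) / real (b + 2) ^ n)" for N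
      by (intro continuous_on_sum continuous_on_divide continuous_on_const) auto
    ultimately show "continuous_on X \<phi>"
      unfolding \<phi>_def by (intro uniform_limit_theorem[OF always_eventually]) auto
    show "inj_on \<phi> X"
    proof (rule inj_onI)
      fix x y assume x: "x \<in> X" and y: "y \<in> X" and "\<phi> x = \<phi> y"
      then have "(\<lambda>n. c (x (from_nat n))) = (\<lambda>n. c (y (from_nat n)))"
        unfolding \<phi>_def by (intro digit_expansion_inj[of _ b]) (auto intro: cb X)
      then have "c (x (from_nat (to_nat j))) = c (y (from_nat (to_nat j)))" for j :: int by (rule fun_cong)
      then have "c (x j) = c (y j)" for j by simp
      then show "x = y" using c X[OF x] X[OF y] by (auto simp: inj_on_def)
    qed
  qed
qed

text \<open>
  The embedding into the line makes Helly's selection theorem available; continuous functions are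
  carried over by Tietze's extension theorem.
\<close>

lemma mean_functional_represented:
  fixes X :: "'a::metric_space set" and \<phi> :: "'a \<Rightarrow> real"
  assumes X: "compact X" and \<phi>: "continuous_on X \<phi>" "inj_on \<phi> X" and x: "\<And>n. x n \<in> X"
    and conv: "\<And>h::'a \<Rightarrow> real. continuous_on X h \<Longrightarrow> convergent (\<lambda>N. (\<Sum>n=1..N. h (x n)) / real N)"
  shows "\<exists>\<nu>. prob_space \<nu> \<and> sets \<nu> = sets (restrict_space borel X) \<and>
    (\<forall>h::'a \<Rightarrow> real. continuous_on X h \<longrightarrow>
       (\<lambda>N. (\<Sum>n=1..N. h (x n)) / real N) \<longlonglongrightarrow> (\<integral>x. h x \<partial>\<nu>))"
proof -
  define Y where "Y = \<phi> ` X"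
  have Y: "compact Y" "closed Y" "Y \<noteq> {}"
    using compact_continuous_image[OF \<phi>(1) X] compact_imp_closed x unfolding Y_def by auto
  \<comment> \<open>A continuous injection on a compact set has a continuous inverse on its
    image.\<close>
  define \<psi> where "\<psi> = the_inv_into X \<phi>"
  have \<psi>: "continuous_on Y \<psi>" "\<And>z. z \<in> X \<Longrightarrow> \<psi> (\<phi> z) = z" "\<And>y. y \<in> Y \<Longrightarrow> \<psi> y \<in> X"
    unfolding \<psi>_def Y_def using continuous_on_inv_into[OF \<phi>(1) X \<phi>(2)] the_inv_into_f_f[OF \<phi>(2)] by auto
  \<comment> \<open>The index \<open>Suc k\<close> excludes the empty average, so that every
    \<open>\<mu> k\<close> is a probability measure.\<close>
  define \<mu> where "\<mu> k = distr (uniform_count_measure {1..Suc k}) borel (\<lambda>n. \<phi> (x n))" for k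
  have \<mu>_int: "(\<integral>y. g y \<partial>\<mu> k) = (\<Sum>n=1..Suc k. g (\<phi> (x n))) / real (Suc k)"
    if "continuous_on UNIV g" for g :: "real \<Rightarrow> real" and k
    unfolding \<mu>_def using borel_measurable_continuous_onI[OF that]
    by (simp add: integral_distr uniform_count_measure_def lebesgue_integral_point_measure_finite
          sum_divide_distrib del: sum.cl_ivl_Suc)
  have \<mu>_dist: "real_distribution (\<mu> k)" for k
  proof -
    interpret prob_space "uniform_count_measure {1..Suc k}"
      by (rule prob_space_uniform_count_measure) auto
    interpret P: prob_space "\<mu> k" unfolding \<mu>_def by (rule prob_space_distr) simp
    show ?thesis by unfold_locales (simp_all add: \<mu>_def)
  qed
  obtain B where B: "B > 0" "\<And>y. y \<in> Y \<Longrightarrow> norm y < B"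
    using compact_imp_bounded[OF Y(1)] unfolding bounded_pos_less by blast
  have "tight \<mu>"
    unfolding tight_def
  proof (intro conjI allI impI \<mu>_dist)
    fix e :: real assume "e > 0"
    have "measure (\<mu> k) {- B<..B} = 1" for k
    proof -
      interpret prob_space "uniform_count_measure {1..Suc k}"
        by (rule prob_space_uniform_count_measure) auto
      have "\<phi> (x n) \<in> {- B<..B}" for n using B(2)[of "\<phi> (x n)"] x[of n] by (auto simp: Y_def)
      then have "(\<lambda>n. \<phi> (x n)) -` {- B<..B} \<inter> space (uniform_count_measure {1..Suc k})
          = space (uniform_count_measure {1..Suc k})" by blast
      moreover have "measure (\<mu> k) {- B<..B} = measure (uniform_count_measure {1..Suc k})
          ((\<lambda>n. \<phi> (x n)) -` {- B<..B} \<inter> space (uniform_count_measure {1..Suc k}))"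
        unfolding \<mu>_def by (rule measure_distr) auto
      ultimately show ?thesis by (simp only: prob_space)
    qed
    then show "\<exists>a b. a < b \<and> (\<forall>n. 1 - e < measure (\<mu> n) {a<..b})"
      using B(1) \<open>e > 0\<close> by (intro exI[of _ "- B"] exI[of _ B]) simp
  qed
  from tight_imp_convergent_subsubsequence[OF this strict_mono_id]
  obtain r M where r: "strict_mono (r :: nat \<Rightarrow> nat)" and M: "real_distribution M"
    and wc: "weak_conv_m (\<mu> \<circ> r) M" by (auto simp: o_def)
  interpret M: real_distribution M by (rule M)
  have lim: "(\<lambda>k. \<integral>y. g y \<partial>\<mu> (r k)) \<longlonglongrightarrow> (\<integral>y. g y \<partial>M)"
    if "continuous_on UNIV g" "\<And>y. norm (g y) \<le> C" for g :: "real \<Rightarrow> real" and C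
    using weak_conv_imp_integral_bdd_continuous_conv[OF _ M wc, of g C] \<mu>_dist that
    by (simp add: continuous_on_eq_continuous_at)
  \<comment> \<open>The truncated distance to \<open>Y\<close> is a bounded continuous function with
    integral 0 under every \<open>\<mu> (r k)\<close>, hence under \<open>M\<close>;
    \<open>Y\<close> is closed.\<close>
  have "AE y in M. y \<in> Y"
  proof -
    let ?g = "\<lambda>y. min 1 (infdist y Y)"
    have g: "continuous_on UNIV ?g" by (intro continuous_intros)
    have "(\<integral>y. ?g y \<partial>\<mu> (r k)) = 0" for k
    proof -
      have "infdist (\<phi> (x n)) Y = 0" for n using x[of n] by (simp add: Y_def)
      then show ?thesis by (simp only: \<mu>_int[OF g]) simp
    qed
    moreover have "(\<lambda>k. \<integral>y. ?g y \<partial>\<mu> (r k)) \<longlonglongrightarrow> (\<integral>y. ?g y \<partial>M)"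
      by (rule lim[OF g, of 1]) (simp add: infdist_nonneg)
    ultimately have "(\<integral>y. ?g y \<partial>M) = 0" by (simp only: LIMSEQ_const_iff)
    moreover have "integrable M ?g"
      using borel_measurable_continuous_onI[OF g]
      by (intro M.integrable_const_bound[where B = 1]) (auto simp: infdist_nonneg)
    ultimately have "AE y in M. ?g y = 0"
      by (subst (asm) integral_nonneg_eq_0_iff_AE) (auto simp: infdist_nonneg)
    then show ?thesis
    proof eventually_elim
      case (elim y)
      then have "infdist y Y = 0" by (auto simp: min_def split: if_splits)
      then show ?case using in_closed_iff_infdist_zero[OF Y(2,3)] by simp
    qed
  qed
  \<comment> \<open>The value \<open>x 0\<close> off \<open>Y\<close> affects only a null set and
    makes the map total with values in \<open>X\<close>.\<close>
  define \<Psi> where "\<Psi> y = (if y \<in> Y then \<psi> y else x 0)" for y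
  have "\<Psi> \<in> borel_measurable borel"
    unfolding \<Psi>_def using Y(2) \<psi>(1) by (intro borel_measurable_continuous_on_if) auto
  then have "\<Psi> \<in> measurable borel (restrict_space borel X)"
    using \<psi>(3) x by (intro measurable_restrict_space2) (auto simp: \<Psi>_def)
  then have \<Psi>: "\<Psi> \<in> measurable M (restrict_space borel X)" by simp
  define \<nu> where "\<nu> = distr M (restrict_space borel X) \<Psi>"
  show ?thesis
  proof (intro exI conjI allI impI)
    show "prob_space \<nu>" unfolding \<nu>_def by (rule M.prob_space_distr[OF \<Psi>])
    show "sets \<nu> = sets (restrict_space borel X)" by (simp add: \<nu>_def)
    fix h :: "'a \<Rightarrow> real" assume h: "continuous_on X h"
    have h\<psi>: "continuous_on Y (\<lambda>y. h (\<psi> y))"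
      using \<psi>(3) by (intro continuous_on_compose2[OF h \<psi>(1)]) auto
    obtain C where C: "C \<ge> 0" "\<And>y. y \<in> Y \<Longrightarrow> norm (h (\<psi> y)) \<le> C"
    proof -
      obtain C where "C > 0" "\<And>v. v \<in> (\<lambda>y. h (\<psi> y)) ` Y \<Longrightarrow> norm v \<le> C"
        using compact_imp_bounded[OF compact_continuous_image[OF h\<psi> Y(1)]] unfolding bounded_pos by blast
      then show thesis using that[of C] by auto
    qed
    obtain g where g: "continuous_on UNIV g" "\<And>y. y \<in> Y \<Longrightarrow> g y = h (\<psi> y)" "\<And>y. norm (g y) \<le> C"
      using Tietze[OF h\<psi> _ C, of UNIV] Y(2) by auto
    obtain c where c: "(\<lambda>N. (\<Sum>n=1..N. h (x n)) / real N) \<longlonglongrightarrow> c"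
      using conv[OF h] unfolding convergent_def by blast
    have "(\<integral>z. h z \<partial>\<nu>) = (\<integral>y. h (\<Psi> y) \<partial>M)"
      unfolding \<nu>_def by (rule integral_distr[OF \<Psi> borel_measurable_continuous_on_restrict[OF h]])
    also have "\<dots> = (\<integral>y. g y \<partial>M)"
    proof (rule integral_cong_AE)
      show "AE y in M. h (\<Psi> y) = g y"
        using \<open>AE y in M. y \<in> Y\<close> by eventually_elim (simp add: \<Psi>_def g(2))
      show "(\<lambda>y. h (\<Psi> y)) \<in> borel_measurable M"
        using measurable_compose[OF \<Psi> borel_measurable_continuous_on_restrict[OF h]] .
      show "g \<in> borel_measurable M" using borel_measurable_continuous_onI[OF g(1)] by simp
    qed
    \<comment> \<open>Helly gives convergence only along \<open>r\<close>; the averages converge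
      along the full sequence, so the integral against \<open>M\<close> is their limit.\<close>
    also have "\<dots> = c"
    proof (rule LIMSEQ_unique[OF lim[OF g(1,3)]])
      have "g (\<phi> (x n)) = h (x n)" for n using g(2)[of "\<phi> (x n)"] x[of n] \<psi>(2) by (simp add: Y_def)
      then have "(\<lambda>k. \<integral>y. g y \<partial>\<mu> (r k)) = (\<lambda>N. (\<Sum>n=1..N. h (x n)) / real N) \<circ> (\<lambda>k. Suc (r k))"
        by (simp only: \<mu>_int[OF g(1)] o_def)
      moreover have "filterlim (\<lambda>k. Suc (r k)) sequentially sequentially"
        using filterlim_compose[OF filterlim_Suc filterlim_subseq[OF r]] .
      ultimately show "(\<lambda>k. \<integral>y. g y \<partial>\<mu> (r k)) \<longlonglongrightarrow> c"
        using filterlim_compose[OF c] by (simp only: o_def)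
    qed
    finally show "(\<lambda>N. (\<Sum>n=1..N. h (x n)) / real N) \<longlonglongrightarrow> (\<integral>x. h x \<partial>\<nu>)" using c by simp
  qed
qed

context finite_valued_near_periodic
begin

lemma unique_furstenberg_system: "unique_furstenberg_system f"
proof -
  obtain \<phi> :: "(int \<Rightarrow> complex) \<Rightarrow> real" where \<phi>: "continuous_on X \<phi>" "inj_on \<phi> X"
    using finite_valued_sequences_embed[of "insert 0 (f ` {0<..})" X] finite_values
      orbit_closure_values[OF finite_values] by blast
  have conv: "convergent (\<lambda>N. (\<Sum>n=1..N. h (orbit_point f n)) / real N)"
    if "continuous_on X h" for h :: "(int \<Rightarrow> complex) \<Rightarrow> real"
    by (rule observable_mean[OF that]) (auto simp: convergent_def)
  obtain \<nu> where "prob_space \<nu>" "sets \<nu> = sets (restrict_space borel X)"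
    "\<forall>h :: _ \<Rightarrow> real. continuous_on X h \<longrightarrow>
       (\<lambda>N. (\<Sum>n=1..N. h (orbit_point f n)) / real N) \<longlonglongrightarrow> (\<integral>x. h x \<partial>\<nu>)"
    using mean_functional_represented[of X \<phi> "orbit_point f",
        OF compact_orbit_closure[OF finite_values] \<phi> orbit_point_in_closure conv] by blast
  then have "weak_star_tendsto X (empirical_measure f) \<nu>"
    by (simp add: weak_star_tendsto_def integral_empirical_measure_orbit_point)
  then show ?thesis unfolding unique_furstenberg_system_def by blast
qed

end

theorem corollary2p7:
  fixes f :: "nat \<Rightarrow> complex"
  assumes "f \<in> mult_unit_disc"
    and "pretentious f"
    and "finite (f ` {0<..})"
  shows "unique_furstenberg_system f \<and>
    (\<forall>\<nu>. furstenberg_system f \<nu> \<longrightarrow> ergodic_system \<nu> left_shift) \<and>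
    rationally_almost_periodic f"
proof -
  obtain q \<psi> where \<psi>: "dirichlet_character q \<psi>" "f 1 = 1"
    "(\<lambda>p. 1 / real p) summable_on {p. prime p \<and> f p \<noteq> \<psi> p}"
    by (rule summable_primes_ne_character[OF assms])
  have near: "\<exists>g r. r > 0 \<and> (\<forall>n. g (n + r) = g n) \<and> (\<forall>n. norm (g n) \<le> 1) \<and>
      (\<forall>N. real (card {n\<in>{1..N}. f n \<noteq> g n}) \<le> e * real N)" if e: "e > 0" for e
  proof (rule multiplicative_near_periodic[OF assms(1) \<psi> e])
    fix g r assume "r > 0" "\<And>n. g (n + r) = g n" "\<And>n. norm (g n) \<le> 1"
      "\<And>N. real (card {n\<in>{1..N}. f n \<noteq> g n}) \<le> e * real N"
    then show ?thesis by (intro exI[of _ g] exI[of _ r]) simp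
  qed
  interpret finite_valued_near_periodic f
  proof
    show "finite (f ` {0<..})" by (rule assms(3))
    show "\<exists>g r. r > 0 \<and> (\<forall>n. g (n + r) = g n) \<and>
      (\<forall>N. real (card {n\<in>{1..N}. f n \<noteq> g n}) \<le> e * real N)" if "e > 0" for e
      using near[OF that] by meson
  qed
  have "rationally_almost_periodic f"
    unfolding rationally_almost_periodic_def
  proof (intro allI impI)
    fix e :: real assume e: "e > 0"
    then have "e / 4 > 0" by simp
    \<comment> \<open>Where f and g differ, the distance is at most 2, so density e/4 gives mean
      distance at most e/2, strictly below e. This uses the bound on \<open>g\<close>, which the
      locale does not record.\<close>
    from near[OF this] obtain g r where g: "r > 0" "\<forall>n. g (n + r) = g n" "\<forall>n. norm (g n) \<le> 1"
      and card: "\<forall>N. real (card {n\<in>{1..N}. f n \<noteq> g n}) \<le> e / 4 * real N" by blast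
    have "1 / real N * (\<Sum>n\<in>{1..<N}. norm (f n - g n)) \<le> e / 2" for N
    proof (cases "N = 0")
      case False
      have f_le: "norm (f n) \<le> 1" if "n > 0" for n using assms(1) that unfolding mult_unit_disc_def by blast
      have "(\<Sum>n\<in>{1..<N}. norm (f n - g n)) \<le> (\<Sum>n\<in>{1..N}. norm (f n - g n))"
        by (rule sum_mono2) auto
      also have "\<dots> = (\<Sum>n\<in>{n\<in>{1..N}. f n \<noteq> g n}. norm (f n - g n))"
        by (rule sum.mono_neutral_right) auto
      also have "\<dots> \<le> (\<Sum>n\<in>{n\<in>{1..N}. f n \<noteq> g n}. 2)"
      proof (rule sum_mono)
        fix n assume "n \<in> {n\<in>{1..N}. f n \<noteq> g n}"
        then have "norm (f n) \<le> 1" using f_le by simp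
        then show "norm (f n - g n) \<le> 2" using g(3) norm_triangle_ineq4[of "f n" "g n"]
          by (smt (verit))
      qed
      also have "\<dots> \<le> e / 2 * real N" using spec[OF card, of N] by simp
      finally show ?thesis using False by (simp add: field_simps)
    qed (use e in simp)
    then have "limsup (\<lambda>N. ereal (1 / real N * (\<Sum>n\<in>{1..<N}. norm (f n - g n)))) \<le> ereal (e / 2)"
      by (intro Limsup_bounded always_eventually allI) simp
    also have "\<dots> < ereal e" using e by simp
    finally show "\<exists>g. periodic_seq g \<and>
        limsup (\<lambda>N. ereal (1 / real N * (\<Sum>n\<in>{1..<N}. norm (f n - g n)))) < ereal e"
      using g unfolding periodic_seq_def by blast
  qed
  then show ?thesis using unique_furstenberg_system furstenberg_system_ergodic by blast
qed

end
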